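(* Let $K$ be a compact subset of a compact connected surface $S$ and let $U$ be a residual domain of $K$. If $K$ has $m$ connected components (with $m$ finite), then $U$ has at most $m(g+1)$ ideal boundary points, where $g$ is the genus of $S$.
   Context: Surfaces are smooth, connected and without boundary (not necessarily orientable). A residual domain of a compact set $K\subset S$ is a connected component of $S\setminus K$. The genus of a connected surface is the maximum number of pairwise disjoint simple closed curves that can be embedded in it without disconnecting it. $\mathrm{fr}_B A$ and $\mathrm{cl}_B A$ denote frontier and closure of $A$ in $B$. An ideal boundary component of $U$ is a decreasing sequence $(P_n)$ of non-empty open connected subsets of $U$ with $\mathrm{fr}_U P_n$ compact for every $n$ and $\bigcap_n \mathrm{cl}_U P_n=\varnothing$. Two such sequences $(P_n)$ and $(Q_m)$ are equivalent if for every $n$ there is $m$ with $P_n\subset Q_m$ and vice versa. An ideal boundary point (end) of $U$ is an equivalence class of ideal boundary components.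
   Formalization: Equivalence of ideal boundary components is taken in the standard sense: every Q_m contains some P_n and every P_n contains some Q_m; the printed condition (each P_n inside some Q_m and vice versa) only says P_0 = Q_0 for decreasing sequences and makes the bound false. *)

theory Defs
  imports "HOL-Analysis.Analysis" "HOL-Library.Extended_Nat"
begin

section \<open>Smooth surfaces\<close>

text \<open>Meaningful for open \<open>S\<close>, the only case used: all iterated directional derivatives
  of order at most \<open>k\<close> exist and are continuous.\<close>

fun Ck_on :: "nat \<Rightarrow> ('v::real_normed_vector \<Rightarrow> 'w::real_normed_vector) \<Rightarrow> 'v set \<Rightarrow> bool" where
  "Ck_on 0 f S \<longleftrightarrow> continuous_on S f"
| "Ck_on (Suc k) f S \<longleftrightarrow>
     (\<forall>x\<in>S. f differentiable (at x)) \<and> (\<forall>v. Ck_on k (\<lambda>x. frechet_derivative f (at x) v) S)"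

definition smooth_on :: "('v::real_normed_vector \<Rightarrow> 'w::real_normed_vector) \<Rightarrow> 'v set \<Rightarrow> bool" where
  "smooth_on f S \<longleftrightarrow> (\<forall>k. Ck_on k f S)"

text \<open>A chart is a pair of its domain and its coordinate map; the values of the coordinate map
  outside the domain are irrelevant.\<close>

definition chart :: "'a topology \<Rightarrow> 'a set \<times> ('a \<Rightarrow> real^2) \<Rightarrow> bool" where
  "chart X = (\<lambda>(V, \<phi>). openin X V \<and> open (\<phi> ` V) \<and>
     homeomorphic_map (subtopology X V) (top_of_set (\<phi> ` V)) \<phi>)"

definition smooth_atlas :: "'a topology \<Rightarrow> ('a set \<times> ('a \<Rightarrow> real^2)) set \<Rightarrow> bool" where
  "smooth_atlas X \<A> \<longleftrightarrow>
     (\<forall>c\<in>\<A>. chart X c) \<and> \<Union>(fst ` \<A>) = topspace X \<and>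
     (\<forall>(V, \<phi>)\<in>\<A>. \<forall>(W, \<psi>)\<in>\<A>. smooth_on (\<psi> \<circ> inv_into V \<phi>) (\<phi> ` (V \<inter> W)))"

definition smooth_surface :: "'a topology \<Rightarrow> bool" where
  "smooth_surface X \<longleftrightarrow> connected_space X \<and> Hausdorff_space X \<and> second_countable X \<and>
     (\<exists>\<A>. smooth_atlas X \<A>)"

section \<open>Genus\<close>

definition simple_closed_curve_in :: "'a topology \<Rightarrow> 'a set \<Rightarrow> bool" where
  "simple_closed_curve_in X C \<longleftrightarrow>
     (\<exists>\<gamma>. embedding_map (top_of_set (sphere (0::complex) 1)) X \<gamma> \<and> C = \<gamma> ` sphere 0 1)"

text \<open>The curves are removed all at once. The maximum is taken in \<^typ>\<open>enat\<close>, so that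
  the genus is infinite if the number of curves is unbounded.\<close>

definition genus :: "'a topology \<Rightarrow> enat" where
  "genus X = Sup {enat (card \<C>) |\<C>. finite \<C> \<and> (\<forall>C\<in>\<C>. simple_closed_curve_in X C) \<and>
     pairwise disjnt \<C> \<and> connected_space (subtopology X (topspace X - \<Union>\<C>))}"

section \<open>Residual domains and ideal boundary points\<close>

definition residual_domain :: "'a topology \<Rightarrow> 'a set \<Rightarrow> 'a set \<Rightarrow> bool" where
  "residual_domain X K U \<longleftrightarrow> U \<in> connected_components_of (subtopology X (topspace X - K))"

definition ideal_boundary_component :: "'a topology \<Rightarrow> (nat \<Rightarrow> 'a set) \<Rightarrow> bool" where
  "ideal_boundary_component Y P \<longleftrightarrow> decseq P \<and>
     (\<forall>n. P n \<noteq> {} \<and> openin Y (P n) \<and> connectedin Y (P n) \<and> compactin Y (Y frontier_of P n)) \<and>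
     (\<Inter>n. Y closure_of P n) = {}"

text \<open>Each sequence is eventually inside every term of the other one. (The other order of
  quantifiers, every \<open>P n\<close> being contained in some \<open>Q m\<close> and conversely, would for
  decreasing sequences only say that \<open>P 0 = Q 0\<close>.)\<close>

definition ideal_boundary_equiv :: "'a topology \<Rightarrow> ((nat \<Rightarrow> 'a set) \<times> (nat \<Rightarrow> 'a set)) set" where
  "ideal_boundary_equiv Y = {(P, Q). ideal_boundary_component Y P \<and> ideal_boundary_component Y Q \<and>
     (\<forall>m. \<exists>n. P n \<subseteq> Q m) \<and> (\<forall>n. \<exists>m. Q m \<subseteq> P n)}"

lemma equiv_ideal_boundary_equiv:
  "equiv {P. ideal_boundary_component Y P} (ideal_boundary_equiv Y)"
proof (rule equivI)
  show "trans (ideal_boundary_equiv Y)"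
    unfolding ideal_boundary_equiv_def trans_def by clarsimp (meson subset_trans)
qed (auto simp: ideal_boundary_equiv_def refl_on_def sym_def)

definition ideal_boundary_points :: "'a topology \<Rightarrow> (nat \<Rightarrow> 'a set) set set" where
  "ideal_boundary_points Y = {P. ideal_boundary_component Y P} // ideal_boundary_equiv Y"

definition num_ideal_boundary_points :: "'a topology \<Rightarrow> enat" where
  "num_ideal_boundary_points Y =
     (if finite (ideal_boundary_points Y) then enat (card (ideal_boundary_points Y)) else \<infinity>)"

end

theory Submission
  imports Defs
begin

text \<open>Suppose that the genus \<open>g\<close> is finite and that \<open>U\<close> has more than \<open>m (g + 1)\<close> ends. By
compactness of the surface, the sets \<open>P n\<close> of an end accumulate at a point outside \<open>U\<close>, hence at a
point of \<open>K\<close>. By the pigeonhole principle some component \<open>Q\<close> of \<open>K\<close> is reached by at least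
\<open>g + 2\<close> ends. It remains to find \<open>g + 1\<close> disjoint simple closed curves in \<open>U\<close> such that every piece
into which they cut \<open>U\<close> still contains a tail of one of these ends
(\<open>nonseparating_curve_family\<close>). Every piece then has points of \<open>Q\<close> in its closure, so the connected
set \<open>Q\<close> glues all pieces together, and the curves do not disconnect the surface
(\<open>connected_complement_of_curves\<close>). This contradicts the definition of the genus.

The curves are found one at a time. The single step (\<open>separating_curve\<close>) says: each compact
subset of \<open>U\<close> has a compact neighbourhood \<open>N\<close> in \<open>U\<close> such that, if the subset separates two points
\<open>p\<close> and \<open>q\<close> of \<open>U - N\<close>, then \<open>N\<close> contains a simple closed curve \<open>C\<close> for which every component of
\<open>U - C\<close> contains \<open>p\<close> or \<open>q\<close>. So cutting along \<open>C\<close> either leaves \<open>U\<close> connected,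
in which case an end may be discarded, or distributes the ends over two pieces, both of which
receive some; an induction on the number of ends gives one curve less than there are ends.

For the single step, cover the compact set by finitely many coordinate squares and move their sides
into general position, which is possible by Sard's theorem in dimension one. The sides then form a
finite graph, and this graph separates \<open>p\<close> from \<open>q\<close>. Take a set \<open>M\<close> of edges that is minimal with the
property that \<open>M\<close> together with all vertices separates \<open>p\<close> from \<open>q\<close>. By minimality the component
of \<open>p\<close> and the component of \<open>q\<close> meet along every edge of \<open>M\<close>, one on each side. Three things follow.
There are no further components, because finitely many points do not disconnect a surface. No edge of
\<open>M\<close> has a free end, because a disc slit along a radius is connected; hence \<open>M\<close> contains a simple
closed curve \<open>C\<close>. Finally, every component of \<open>U - C\<close> meets the component of \<open>p\<close> or that
of \<open>q\<close>, because the union of these two is dense in \<open>U\<close> (\<open>finite_graph_cut_curve\<close>).\<close>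

section \<open>Components of subsets\<close>

abbreviation joined_in :: "'a topology \<Rightarrow> 'a set \<Rightarrow> 'a \<Rightarrow> 'a \<Rightarrow> bool" where
  "joined_in X S x y \<equiv> connected_component_of (subtopology X S) x y"

abbreviation component_in :: "'a topology \<Rightarrow> 'a set \<Rightarrow> 'a \<Rightarrow> 'a set" where
  "component_in X S x \<equiv> connected_component_of_set (subtopology X S) x"

lemma joined_in_iff:
  "joined_in X S x y \<longleftrightarrow> (\<exists>T. connectedin X T \<and> T \<subseteq> S \<and> x \<in> T \<and> y \<in> T)"
  unfolding connected_component_of_def by (auto simp: connectedin_subtopology)

lemma joined_in_refl: "x \<in> S \<Longrightarrow> S \<subseteq> topspace X \<Longrightarrow> joined_in X S x x"
  by (auto simp: connected_component_of_refl)

lemma component_in_subset: "component_in X S x \<subseteq> S"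
  using connected_component_in_topspace by fastforce

lemma connectedin_component_in: "connectedin X (component_in X S x)"
  using connectedin_connected_component_of[of "subtopology X S" x] by (simp add: connectedin_subtopology)

lemma component_in_absorb:
  assumes "connectedin X T" "T \<subseteq> S" "T \<inter> component_in X S x \<noteq> {}"
  shows "T \<subseteq> component_in X S x"
proof -
  from assms(3) obtain y where y: "y \<in> T" "joined_in X S x y" by auto
  have "joined_in X S y z" if "z \<in> T" for z
    using assms y that by (auto simp: joined_in_iff)
  then show ?thesis using y(2) by (auto intro: connected_component_of_trans)
qed

lemma connectedin_open_split:
  assumes "connectedin X T" "openin X A" "openin X B" "T \<subseteq> A \<union> B" "A \<inter> B \<inter> T = {}" "T \<inter> A \<noteq> {}"
  shows "T \<inter> B = {}"
  using connectedinD[OF assms(1-5)] assms(6) by blast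

section \<open>Charts and their inverses\<close>

locale surface_atlas =
  fixes X :: "'a topology" and \<A> :: "('a set \<times> ('a \<Rightarrow> real^2)) set"
  assumes hausdorff: "Hausdorff_space X" and atlas: "smooth_atlas X \<A>"

definition chart_image :: "'a set \<times> ('a \<Rightarrow> real^2) \<Rightarrow> (real^2) set" where
  "chart_image c = snd c ` fst c"

definition chart_inv :: "'a set \<times> ('a \<Rightarrow> real^2) \<Rightarrow> real^2 \<Rightarrow> 'a" where
  "chart_inv c = inv_into (fst c) (snd c)"

context surface_atlas
begin

lemma chart_of_atlas: assumes "c \<in> \<A>"
  shows "openin X (fst c)" "open (chart_image c)"
    "homeomorphic_map (subtopology X (fst c)) (top_of_set (chart_image c)) (snd c)"
proof -
  have "chart X c" using atlas assms by (auto simp: smooth_atlas_def)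
  then show "openin X (fst c)" "open (chart_image c)"
    "homeomorphic_map (subtopology X (fst c)) (top_of_set (chart_image c)) (snd c)"
    by (auto simp: chart_def chart_image_def split: prod.splits)
qed

lemma chart_domain_subset: "c \<in> \<A> \<Longrightarrow> fst c \<subseteq> topspace X"
  using chart_of_atlas(1) openin_subset by blast

lemma chart_domain_topspace: "c \<in> \<A> \<Longrightarrow> topspace X \<inter> fst c = fst c"
  by (metis chart_domain_subset inf.absorb2)

lemma inj_on_chart: "c \<in> \<A> \<Longrightarrow> inj_on (snd c) (fst c)"
  using homeomorphic_imp_injective_map[OF chart_of_atlas(3)] by (simp add: chart_domain_topspace)

lemma chart_inv_chart: "c \<in> \<A> \<Longrightarrow> x \<in> fst c \<Longrightarrow> chart_inv c (snd c x) = x"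
  using inj_on_chart by (simp add: chart_inv_def)

lemma chart_chart_inv: "y \<in> chart_image c \<Longrightarrow> snd c (chart_inv c y) = y"
  by (simp add: chart_inv_def chart_image_def f_inv_into_f)

lemma chart_inv_in: "y \<in> chart_image c \<Longrightarrow> chart_inv c y \<in> fst c"
  by (simp add: chart_inv_def chart_image_def inv_into_into)

lemma chart_in_image: "x \<in> fst c \<Longrightarrow> snd c x \<in> chart_image c"
  by (simp add: chart_image_def)

lemma inj_on_chart_inv: "inj_on (chart_inv c) (chart_image c)"
  by (metis chart_chart_inv inj_onI)

lemma homeomorphic_chart_inv: assumes "c \<in> \<A>"
  shows "homeomorphic_map (top_of_set (chart_image c)) (subtopology X (fst c)) (chart_inv c)"
proof -
  obtain g where g: "homeomorphic_maps (subtopology X (fst c)) (top_of_set (chart_image c)) (snd c) g"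
    using chart_of_atlas(3)[OF assms] by (auto simp: homeomorphic_map_maps)
  have "homeomorphic_map (top_of_set (chart_image c)) (subtopology X (fst c)) g"
    using g homeomorphic_maps_map by blast
  moreover have "g y = chart_inv c y" if "y \<in> chart_image c" for y
  proof -
    have "g y \<in> fst c" "snd c (g y) = y"
      using g that assms chart_domain_topspace unfolding homeomorphic_maps_def continuous_map_def by auto
    then show ?thesis using chart_inv_chart[OF assms] by force
  qed
  ultimately show ?thesis by (metis homeomorphic_map_eq topspace_euclidean_subtopology)
qed

lemma continuous_chart_inv: assumes "c \<in> \<A>"
  shows "continuous_map (top_of_set (chart_image c)) X (chart_inv c)"
  using homeomorphic_imp_continuous_map[OF homeomorphic_chart_inv[OF assms]]
  by (simp add: continuous_map_in_subtopology)

lemma open_chart_inv_image: assumes "c \<in> \<A>" "open S" "S \<subseteq> chart_image c"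
  shows "openin X (chart_inv c ` S)"
proof -
  have "openin (top_of_set (chart_image c)) S" using assms by (simp add: open_subset)
  then have "openin (subtopology X (fst c)) (chart_inv c ` S)"
    using homeomorphic_imp_open_map[OF homeomorphic_chart_inv[OF assms(1)]] by (auto simp: open_map_def)
  then show ?thesis using chart_of_atlas(1)[OF assms(1)] openin_trans_full by blast
qed

lemma connected_chart_inv_image: assumes "c \<in> \<A>" "connected S" "S \<subseteq> chart_image c"
  shows "connectedin X (chart_inv c ` S)"
  by (rule connectedin_continuous_map_image[OF continuous_chart_inv[OF assms(1)]])
    (use assms in \<open>simp add: connectedin_subtopology\<close>)

lemma compact_chart_inv_image: assumes "c \<in> \<A>" "compact S" "S \<subseteq> chart_image c"
  shows "compactin X (chart_inv c ` S)"
  by (rule image_compactin[OF _ continuous_chart_inv[OF assms(1)]])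
    (use assms in \<open>simp add: compactin_subtopology\<close>)

lemma open_chart_preimage: assumes "c \<in> \<A>" "openin X W"
  shows "open {y \<in> chart_image c. chart_inv c y \<in> W}"
  using openin_continuous_map_preimage[OF continuous_chart_inv[OF assms(1)] assms(2)]
    chart_of_atlas(2)[OF assms(1)] by (simp add: openin_open_eq)

lemma chart_inv_closure: assumes "c \<in> \<A>" "S \<subseteq> chart_image c" "y \<in> chart_image c" "y \<in> closure S"
  shows "chart_inv c y \<in> X closure_of (chart_inv c ` S)"
proof -
  have "y \<in> (top_of_set (chart_image c)) closure_of S"
    using assms by (simp add: closure_of_subtopology Int_absorb1)
  then show ?thesis
    using continuous_map_image_closure_subset[OF continuous_chart_inv[OF assms(1)], of S] by blast
qed

lemma chart_ball: assumes "c \<in> \<A>" "openin X W" "x \<in> W" "x \<in> fst c"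
  obtains r where "r > 0" "ball (snd c x) r \<subseteq> chart_image c" "chart_inv c ` ball (snd c x) r \<subseteq> W"
proof -
  have "snd c x \<in> {y \<in> chart_image c. chart_inv c y \<in> W}"
    using assms by (simp add: chart_in_image chart_inv_chart)
  then obtain r where "r > 0" "ball (snd c x) r \<subseteq> {y \<in> chart_image c. chart_inv c y \<in> W}"
    using open_chart_preimage[OF assms(1,2)] openE by blast
  then show ?thesis using that[of r] by auto
qed

section \<open>Local connectedness, and removing finitely many points\<close>

lemma exists_chart: assumes "x \<in> topspace X" obtains c where "c \<in> \<A>" "x \<in> fst c"
proof -
  have "x \<in> \<Union>(fst ` \<A>)" using atlas assms by (simp add: smooth_atlas_def)
  then show ?thesis using that by blast
qed

lemma openin_component_in: assumes "openin X W"
  shows "openin X (component_in X W x)"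
proof (subst openin_subopen, intro ballI)
  fix y assume y: "y \<in> component_in X W x"
  then have yW: "y \<in> W" using component_in_subset by fast
  then obtain c where c: "c \<in> \<A>" "y \<in> fst c" using exists_chart assms openin_subset by blast
  obtain r where r: "r > 0" "ball (snd c y) r \<subseteq> chart_image c" "chart_inv c ` ball (snd c y) r \<subseteq> W"
    using chart_ball[OF c(1) assms yW c(2)] by blast
  let ?B = "chart_inv c ` ball (snd c y) r"
  have "y \<in> ?B" using r(1) chart_inv_chart[OF c] by (metis centre_in_ball image_eqI)
  moreover have "connectedin X ?B" using connected_chart_inv_image[OF c(1) _ r(2)] by simp
  ultimately have "?B \<subseteq> component_in X W x"
    using component_in_absorb r(3) y by (metis disjoint_iff)
  moreover have "openin X ?B" using open_chart_inv_image[OF c(1) _ r(2)] by simp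
  ultimately show "\<exists>T. openin X T \<and> y \<in> T \<and> T \<subseteq> component_in X W x" using \<open>y \<in> ?B\<close> by blast
qed

lemma closedin_finite: "finite F \<Longrightarrow> F \<subseteq> topspace X \<Longrightarrow> closedin X F"
  using hausdorff by (simp add: Hausdorff_imp_t1_space closedin_Hausdorff_finite)

lemma openin_diff_finite:
  assumes "openin X W" "finite F" shows "openin X (W - F)"
proof -
  have "W - F = W - (F \<inter> topspace X)" using openin_subset[OF assms(1)] by blast
  moreover have "closedin X (F \<inter> topspace X)" using closedin_finite assms by simp
  ultimately show ?thesis using assms by (metis openin_diff)
qed

text \<open>The plane minus a point is locally connected at that point: this is why points do not separate a surface.\<close>

lemma punctured_neighbourhood:
  assumes "openin X W" "v \<in> W"
  obtains B where "openin X B" "v \<in> B" "B \<subseteq> W" "connectedin X (B - {v})"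
proof -
  obtain c where c: "c \<in> \<A>" "v \<in> fst c" using exists_chart assms openin_subset by blast
  obtain r where r: "r > 0" "ball (snd c v) r \<subseteq> chart_image c" "chart_inv c ` ball (snd c v) r \<subseteq> W"
    using chart_ball[OF c(1) assms c(2)] by blast
  let ?B = "chart_inv c ` ball (snd c v) r" and ?B' = "chart_inv c ` (ball (snd c v) r - {snd c v})"
  have B': "connectedin X ?B'"
    using connected_chart_inv_image[OF c(1), of "ball (snd c v) r - {snd c v}"] r(2)
      connected_punctured_ball[where 'N="real^2"] by fastforce
  have "?B - {v} = ?B'"
    using chart_inv_chart[OF c] inj_on_image_set_diff[OF inj_on_subset[OF inj_on_chart_inv r(2)], of "ball (snd c v) r" "{snd c v}"] r(1)
    by auto
  moreover have "v \<in> ?B" using r(1) chart_inv_chart[OF c] by (metis centre_in_ball image_eqI)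
  ultimately show ?thesis
    using that[of ?B] open_chart_inv_image[OF c(1) _ r(2)] r(3) B' by simp
qed

text \<open>If \<open>W - {v}\<close> fell into two open parts, a small punctured disc around \<open>v\<close>, being connected,
would lie in one of them. Adding \<open>v\<close> to that part would disconnect \<open>W\<close>.\<close>

lemma connectedin_diff_point:
  assumes "openin X W" "connectedin X W" shows "connectedin X (W - {v})"
proof (cases "v \<in> W")
  case True
  obtain B where B: "openin X B" "v \<in> B" "B \<subseteq> W" "connectedin X (B - {v})"
    using punctured_neighbourhood[OF assms(1) True] .
  have W': "openin X (W - {v})" using openin_diff_finite[OF assms(1), of "{v}"] by simp
  have half: False if A: "openin X A" "openin X A'" and cov: "W - {v} \<subseteq> A \<union> A'"
    and disj: "A \<inter> A' \<inter> (W - {v}) = {}" and ne: "A' \<inter> (W - {v}) \<noteq> {}" and far: "(B - {v}) \<inter> A' = {}" for A A'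
  proof -
    have 1: "W \<subseteq> (A \<union> B) \<union> (A' \<inter> (W - {v}))" using cov B(2) by auto
    have 2: "(A \<union> B) \<inter> (A' \<inter> (W - {v})) \<inter> W = {}" using disj far by auto
    have "W \<inter> (A' \<inter> (W - {v})) = {}"
      by (rule connectedin_open_split[OF assms(2) _ _ 1 2]) (use A W' B True in auto)
    then show False using ne by auto
  qed
  show ?thesis unfolding connectedin
  proof (intro conjI notI)
    show "W - {v} \<subseteq> topspace X" using openin_subset[OF W'] .
    assume "\<exists>E1 E2. openin X E1 \<and> openin X E2 \<and> W - {v} \<subseteq> E1 \<union> E2 \<and> E1 \<inter> E2 \<inter> (W - {v}) = {} \<and>
       E1 \<inter> (W - {v}) \<noteq> {} \<and> E2 \<inter> (W - {v}) \<noteq> {}"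
    then obtain E1 E2 where E: "openin X E1" "openin X E2" "W - {v} \<subseteq> E1 \<union> E2" "E1 \<inter> E2 \<inter> (W - {v}) = {}"
       "E1 \<inter> (W - {v}) \<noteq> {}" "E2 \<inter> (W - {v}) \<noteq> {}" by blast
    have "(B - {v}) \<inter> E1 = {} \<or> (B - {v}) \<inter> E2 = {}"
      using connectedin_open_split[OF B(4) E(1,2)] B(3) E(3,4) by auto
    then show False using half[OF E(1-4)] half[OF E(2,1)] E by (metis Un_commute inf_commute)
  qed
qed (use assms in simp)

lemma connectedin_diff_finite:
  assumes "openin X W" "connectedin X W" "finite F" shows "connectedin X (W - F)"
  using assms(3)
proof (induction F)
  case (insert v F)
  then have "connectedin X ((W - F) - {v})"
    using connectedin_diff_point[OF openin_diff_finite[OF assms(1) insert.hyps(1)]] by simp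
  then show ?case by (metis Diff_insert)
qed (use assms in simp)

lemma openin_infinite: assumes "openin X W" "W \<noteq> {}" shows "infinite W"
proof -
  obtain v where v: "v \<in> W" using assms by auto
  obtain c where c: "c \<in> \<A>" "v \<in> fst c" using exists_chart v assms openin_subset by blast
  obtain r where r: "r > 0" "ball (snd c v) r \<subseteq> chart_image c" "chart_inv c ` ball (snd c v) r \<subseteq> W"
    using chart_ball[OF c(1) assms(1) v c(2)] by blast
  have "infinite (ball (snd c v) r)" using r(1) finite_imp_not_open[of "ball (snd c v) r"] by auto
  then have "infinite (chart_inv c ` ball (snd c v) r)"
    by (simp add: finite_image_iff[OF inj_on_subset[OF inj_on_chart_inv r(2)]])
  then show ?thesis using r(3) finite_subset by blast
qed

end

section \<open>Arcs, and cycles in finite graphs\<close>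

definition arc_between :: "'a topology \<Rightarrow> 'a set \<Rightarrow> 'a \<Rightarrow> 'a \<Rightarrow> bool" where
  "arc_between X A u v \<longleftrightarrow> (\<exists>\<gamma>. continuous_map (top_of_set {0..1::real}) X \<gamma> \<and> inj_on \<gamma> {0..1} \<and>
     \<gamma> ` {0..1} = A \<and> \<gamma> 0 = u \<and> \<gamma> 1 = v)"

lemma continuous_map_reparametrise:
  assumes "continuous_map (top_of_set S) X \<gamma>" "continuous_on T h" "h ` T \<subseteq> S"
  shows "continuous_map (top_of_set T) X (\<lambda>t. \<gamma> (h t))"
proof -
  have "continuous_map (top_of_set T) (top_of_set S) h"
    using assms by (auto simp: continuous_map_in_subtopology)
  then have "continuous_map (top_of_set T) X (\<gamma> \<circ> h)" using assms(1) by (rule continuous_map_compose)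
  then show ?thesis by (simp add: o_def)
qed

lemma arc_between_subset: "arc_between X A u v \<Longrightarrow> u \<in> A \<and> v \<in> A"
  unfolding arc_between_def by force

lemma arc_between_sym: assumes "arc_between X A u v" shows "arc_between X A v u"
proof -
  obtain \<gamma> where g: "continuous_map (top_of_set {0..1::real}) X \<gamma>" "inj_on \<gamma> {0..1}"
     "\<gamma> ` {0..1} = A" "\<gamma> 0 = u" "\<gamma> 1 = v" using assms by (auto simp: arc_between_def)
  have im: "(\<lambda>t. 1 - t) ` {0..1} = {0..1::real}" by simp
  have "continuous_map (top_of_set {0..1}) X (\<lambda>t. \<gamma> (1 - t))"
    by (rule continuous_map_reparametrise[OF g(1)]) (auto intro: continuous_intros)
  moreover have "inj_on (\<lambda>t. \<gamma> (1 - t)) {0..1}"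
  proof (rule inj_onI)
    fix x y :: real assume "x \<in> {0..1}" "y \<in> {0..1}" "\<gamma> (1 - x) = \<gamma> (1 - y)"
    then have "1 - x = 1 - y" by (intro inj_onD[OF g(2)]) auto
    then show "x = y" by simp
  qed
  moreover have "(\<lambda>t. \<gamma> (1 - t)) ` {0..1} = A"
    using g(3) im by (metis image_image)
  ultimately show ?thesis unfolding arc_between_def using g(4,5) by (intro exI[of _ "\<lambda>t. \<gamma> (1 - t)"]) auto
qed

lemma arc_between_subarc:
  assumes "arc_between X A u v" "w \<in> A" "w \<noteq> v"
  obtains A' where "A' \<subseteq> A" "arc_between X A' w v"
proof -
  obtain \<gamma> where g: "continuous_map (top_of_set {0..1::real}) X \<gamma>" "inj_on \<gamma> {0..1}"
     "\<gamma> ` {0..1} = A" "\<gamma> 0 = u" "\<gamma> 1 = v" using assms by (auto simp: arc_between_def)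
  obtain s where s: "s \<in> {0..1}" "\<gamma> s = w" using assms(2) g(3) by auto
  have "s < 1" using s g(5) assms(3) by (cases "s = 1") auto
  define h where "h t = s + t * (1 - s)" for t
  have h: "h t \<in> {0..1}" if "t \<in> {0..1}" for t
  proof -
    have "t * (1 - s) \<le> 1 * (1 - s)" using that s by (intro mult_right_mono) auto
    then show ?thesis using that s unfolding h_def by auto
  qed
  have "continuous_map (top_of_set {0..1}) X (\<lambda>t. \<gamma> (h t))"
    by (rule continuous_map_reparametrise[OF g(1)]) (use h in \<open>auto simp: h_def intro!: continuous_intros\<close>)
  moreover have "inj_on (\<lambda>t. \<gamma> (h t)) {0..1}"
  proof (rule inj_onI)
    fix x y :: real assume "x \<in> {0..1}" "y \<in> {0..1}" "\<gamma> (h x) = \<gamma> (h y)"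
    then have "h x = h y" using g(2) h by (meson inj_onD)
    then show "x = y" using \<open>s < 1\<close> by (simp add: h_def)
  qed
  moreover have "(\<lambda>t. \<gamma> (h t)) ` {0..1} \<subseteq> A" using h g(3) by auto
  moreover have "\<gamma> (h 0) = w" "\<gamma> (h 1) = v" using s g by (auto simp: h_def)
  ultimately show ?thesis using that unfolding arc_between_def by blast
qed

lemma arc_between_join:
  assumes "arc_between X A u v" "arc_between X B v w" "A \<inter> B = {v}"
  shows "arc_between X (A \<union> B) u w"
proof -
  obtain \<alpha> where a: "continuous_map (top_of_set {0..1::real}) X \<alpha>" "inj_on \<alpha> {0..1}"
     "\<alpha> ` {0..1} = A" "\<alpha> 0 = u" "\<alpha> 1 = v" using assms by (auto simp: arc_between_def)
  obtain \<beta> where b: "continuous_map (top_of_set {0..1::real}) X \<beta>" "inj_on \<beta> {0..1}"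
     "\<beta> ` {0..1} = B" "\<beta> 0 = v" "\<beta> 1 = w" using assms by (auto simp: arc_between_def)
  define g where "g t = (if t \<le> 1/2 then \<alpha> (2 * t) else \<beta> (2 * t - 1))" for t :: real
  have "continuous_map (top_of_set {0..1::real}) X g"
    unfolding g_def
  proof (rule continuous_map_cases_le)
    show "continuous_map (subtopology (top_of_set {0..1}) {x \<in> topspace (top_of_set {0..1}). x \<le> 1/2}) X (\<lambda>t. \<alpha> (2 * t))"
      unfolding subtopology_subtopology
      by (rule continuous_map_reparametrise[OF a(1)]) (auto intro!: continuous_intros)
    show "continuous_map (subtopology (top_of_set {0..1}) {x \<in> topspace (top_of_set {0..1}). 1/2 \<le> x}) X (\<lambda>t. \<beta> (2 * t - 1))"
      unfolding subtopology_subtopology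
      by (rule continuous_map_reparametrise[OF b(1)]) (auto intro!: continuous_intros)
    show "\<alpha> (2 * t) = \<beta> (2 * t - 1)" if "t = 1/2" for t using a(5) b(4) by (simp add: that)
  qed auto
  moreover have "inj_on g {0..1}"
  proof -
    have cross: False if "s \<le> 1/2" "1/2 < t" "s \<in> {0..1}" "t \<in> {0..1}" "g s = g t" for s t
    proof -
      have st: "2 * s \<in> {0..1}" "2 * t - 1 \<in> {0..1}" using that by auto
      have "\<alpha> (2 * s) = \<beta> (2 * t - 1)" using that by (simp add: g_def)
      moreover have "\<alpha> (2 * s) \<in> A" "\<beta> (2 * t - 1) \<in> B" using st a(3) b(3) by blast+
      ultimately have "\<beta> (2 * t - 1) \<in> A \<inter> B" by simp
      then have "\<beta> (2 * t - 1) = \<beta> 0" using assms(3) b(4) by simp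
      then have "2 * t - 1 = 0" using inj_onD[OF b(2) _ st(2), of 0] by simp
      then show False using that by simp
    qed
    show ?thesis
    proof (rule inj_onI)
      fix s t :: real assume st: "s \<in> {0..1}" "t \<in> {0..1}" "g s = g t"
      consider "s \<le> 1/2" "t \<le> 1/2" | "s > 1/2" "t > 1/2" | "s \<le> 1/2" "1/2 < t" | "t \<le> 1/2" "1/2 < s" by linarith
      then show "s = t"
      proof cases
        case 1
        then have "\<alpha> (2 * s) = \<alpha> (2 * t)" using st by (simp add: g_def)
        then have "2 * s = 2 * t" by (rule inj_onD[OF a(2)]) (use 1 st in auto)
        then show ?thesis by simp
      next
        case 2
        then have "\<beta> (2 * s-1) = \<beta> (2 * t-1)" using st by (simp add: g_def)
        then have "2 * s - 1 = 2 * t - 1" by (rule inj_onD[OF b(2)]) (use 2 st in auto)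
        then show ?thesis by simp
      qed (use cross st in metis)+
    qed
  qed
  moreover have "g ` {0..1} = A \<union> B"
  proof (intro equalityI subsetI)
    fix x assume "x \<in> g ` {0..1}"
    then obtain t where "t \<in> {0..1}" "x = g t" by auto
    then show "x \<in> A \<union> B" using a(3) b(3) by (auto simp: g_def)
  next
    fix x assume "x \<in> A \<union> B"
    then consider t where "t \<in> {0..1}" "x = \<alpha> t" | t where "t \<in> {0..1}" "x = \<beta> t" using a(3) b(3) by auto
    then show "x \<in> g ` {0..1}"
    proof cases
      case 1 then have "x = g (t/2)" "t/2 \<in> {0..1}" by (auto simp: g_def)
      then show ?thesis by blast
    next
      case 2
      then have "x = g ((t+1)/2)" "(t+1)/2 \<in> {0..1}" using a(5) b(4)  by (auto simp: g_def field_simps)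
      then show ?thesis by blast
    qed
  qed
  moreover have "g 0 = u" "g 1 = w" using a b by (auto simp: g_def)
  ultimately show ?thesis unfolding arc_between_def by blast
qed

text \<open>On the unit circle the abscissa determines a point up to the sign of the ordinate. So the two
arcs can be laid over the upper and the lower semicircle, parametrised by \<open>(1 - Re z) / 2\<close>.\<close>

lemma simple_closed_curve_two_arcs:
  assumes "Hausdorff_space X" "arc_between X A u v" "arc_between X B u v" "A \<inter> B = {u,v}" 
  shows "simple_closed_curve_in X (A \<union> B)"
proof -
  obtain \<alpha> where a: "continuous_map (top_of_set {0..1::real}) X \<alpha>" "inj_on \<alpha> {0..1}"
     "\<alpha> ` {0..1} = A" "\<alpha> 0 = u" "\<alpha> 1 = v" using assms by (auto simp: arc_between_def)
  obtain \<beta> where b: "continuous_map (top_of_set {0..1::real}) X \<beta>" "inj_on \<beta> {0..1}"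
     "\<beta> ` {0..1} = B" "\<beta> 0 = u" "\<beta> 1 = v" using assms by (auto simp: arc_between_def)
  let ?S = "sphere (0::complex) 1"
  define h where "h z = (1 - Re z) / 2" for z
  have sph: "(Re z)\<^sup>2 + (Im z)\<^sup>2 = 1" if "z \<in> ?S" for z
    using that by (simp add: cmod_def)
  have h: "h z \<in> {0..1}" if "z \<in> ?S" for z
    using that abs_Re_le_cmod[of z] by (auto simp: h_def)
  have hc: "continuous_on T h" for T unfolding h_def by (intro continuous_intros) auto
  have im0: "h z = 0 \<or> h z = 1" if "z \<in> ?S" "Im z = 0" for z
    using sph[OF that(1)] that(2) by (auto simp: h_def power2_eq_1_iff)
  have hinj: "z = z'" if "z \<in> ?S" "z' \<in> ?S" "h z = h z'" "0 \<le> Im z * Im z'" for z z'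
  proof -
    have re: "Re z = Re z'" using that by (simp add: h_def)
    then have "(Im z)\<^sup>2 = (Im z')\<^sup>2" using sph that by (metis add_left_cancel)
    then have "Im z = Im z' \<or> Im z = - Im z'" by (simp add: power2_eq_iff)
    then have "Im z = Im z'" using that(4) by (auto simp: zero_le_mult_iff)
    then show ?thesis using re by (simp add: complex_eq_iff)
  qed
  define g where "g z = (if 0 \<le> Im z then \<alpha> (h z) else \<beta> (h z))" for z
  have "continuous_map (top_of_set ?S) X g"
    unfolding g_def
  proof (rule continuous_map_cases_le)
    show "continuous_map (subtopology (top_of_set ?S) {x \<in> topspace (top_of_set ?S). 0 \<le> Im x}) X (\<lambda>z. \<alpha> (h z))"
      unfolding subtopology_subtopology
      by (rule continuous_map_reparametrise[OF a(1) hc]) (use h in auto)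
    show "continuous_map (subtopology (top_of_set ?S) {x \<in> topspace (top_of_set ?S). Im x \<le> 0}) X (\<lambda>z. \<beta> (h z))"
      unfolding subtopology_subtopology
      by (rule continuous_map_reparametrise[OF b(1) hc]) (use h in auto)
    show "\<alpha> (h x) = \<beta> (h x)" if "x \<in> topspace (top_of_set ?S)" "0 = Im x" for x
      using im0[of x] that a b by auto
  qed (auto intro!: continuous_intros)
  moreover have "inj_on g ?S"
  proof -
    have cross: False if "0 \<le> Im s" "Im t < 0" "s \<in> ?S" "t \<in> ?S" "g s = g t" for s t
    proof -
      have st: "h s \<in> {0..1}" "h t \<in> {0..1}" using that h by auto
      have "\<alpha> (h s) = \<beta> (h t)" using that by (simp add: g_def)
      moreover have "\<alpha> (h s) \<in> A" "\<beta> (h t) \<in> B" using st a(3) b(3) by blast+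
      ultimately have "\<beta> (h t) \<in> A \<inter> B" by simp
      then have "\<beta> (h t) = \<beta> 0 \<or> \<beta> (h t) = \<beta> 1" using assms(4) b(4,5) by auto
      then have "h t = 0 \<or> h t = 1" using inj_onD[OF b(2) _ st(2)] by auto
      then have "Re t = 1 \<or> Re t = -1" by (auto simp: h_def)
      then have "Im t = 0" using sph[OF that(4)] by auto
      then show False using that by simp
    qed
    show ?thesis
    proof (rule inj_onI)
      fix s t assume st: "s \<in> ?S" "t \<in> ?S" "g s = g t"
      consider "Im s \<ge> 0" "Im t \<ge> 0" | "Im s < 0" "Im t < 0" | "0 \<le> Im s" "Im t < 0" | "0 \<le> Im t" "Im s < 0" by linarith
      then show "s = t"
      proof cases
        case 1
        then have "\<alpha> (h s) = \<alpha> (h t)" using st by (simp add: g_def)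
        then have "h s = h t" by (rule inj_onD[OF a(2)]) (use h st in blast)+
        then show ?thesis using hinj st 1 by simp
      next
        case 2
        then have "\<beta> (h s) = \<beta> (h t)" using st by (simp add: g_def)
        then have "h s = h t" by (rule inj_onD[OF b(2)]) (use h st in blast)+
        then show ?thesis using hinj st 2 by (simp add: mult_nonpos_nonpos)
      qed (use cross st in metis)+
    qed
  qed
  ultimately have emb: "embedding_map (top_of_set ?S) X g"
    by (intro continuous_imp_embedding_map[OF _ _ assms(1)]) (auto simp: compact_space_subtopology)
  have "g ` ?S = A \<union> B"
  proof (intro equalityI subsetI)
    fix x assume "x \<in> g ` ?S"
    then obtain z where "z \<in> ?S" "x = g z" by auto
    then show "x \<in> A \<union> B" using a(3) b(3) h by (auto simp: g_def)
  next
    fix x assume "x \<in> A \<union> B"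
    have pt: "\<exists>z\<in>?S. h z = t \<and> 0 \<le> Im z \<and> cnj z \<in> ?S \<and> h (cnj z) = t" if "t \<in> {0..1}" for t
    proof -
      have "0 \<le> t * (1 - t)" using that by simp
      then have "(1 - 2 * t)\<^sup>2 \<le> 1" by (simp add: power2_eq_square algebra_simps)
      then show ?thesis
        by (intro bexI[of _ "Complex (1 - 2 * t) (sqrt (1 - (1 - 2 * t)\<^sup>2))"])
          (auto simp: h_def cmod_def)
    qed
    from \<open>x \<in> A \<union> B\<close> consider t where "t \<in> {0..1}" "x = \<alpha> t" | t where "t \<in> {0..1}" "x = \<beta> t" using a(3) b(3) by auto
    then show "x \<in> g ` ?S"
    proof cases
      case 1 
      then obtain z where "z \<in> ?S" "h z = t" "0 \<le> Im z" using pt by blast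
      then have "x = g z" using 1 by (auto simp: g_def)
      then show ?thesis using \<open>z \<in> ?S\<close> by blast
    next
      case 2
      then obtain z where z: "cnj z \<in> ?S" "h (cnj z) = t" "0 \<le> Im z" using pt by blast
      have "x = g (cnj z)"
      proof (cases "Im z = 0")
        case True
        then have "t = 0 \<or> t = 1" using im0[of "cnj z"] z by simp
        then show ?thesis using 2 z a b True by (auto simp: g_def)
      qed (use 2 z in \<open>auto simp: g_def\<close>)
      then show ?thesis using \<open>cnj z \<in> ?S\<close> by blast
    qed
  qed
  then show ?thesis using emb unfolding simple_closed_curve_in_def by metis
qed

text \<open>A graph in which no edge has a free end contains a cycle. Starting from one edge, an arc
made of edges is prolonged at its end \<open>v\<close>, which lies on only one edge of the arc. A further edge of \<open>M\<close> leads on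
from \<open>v\<close> to a vertex \<open>w\<close>: either \<open>w\<close> lies on the arc, and the part of the arc from \<open>w\<close> to \<open>v\<close>
closes up to a cycle, or the arc becomes longer, which can happen only finitely often.\<close>

lemma graph_contains_simple_closed_curve:
  fixes S V :: "'e \<Rightarrow> 'a set"
  assumes "Hausdorff_space X" "finite M" "M \<noteq> {}"
    and arcs: "\<And>e. e \<in> M \<Longrightarrow> \<exists>u v. V e = {u, v} \<and> u \<noteq> v \<and> arc_between X (S e) u v"
    and meet: "\<And>e e'. e \<in> M \<Longrightarrow> e' \<in> M \<Longrightarrow> e \<noteq> e' \<Longrightarrow> S e \<inter> S e' \<subseteq> V e \<inter> V e'"
    and deg: "\<And>e v. e \<in> M \<Longrightarrow> v \<in> V e \<Longrightarrow> \<exists>e'\<in>M. e' \<noteq> e \<and> v \<in> S e'"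
  shows "\<exists>C. simple_closed_curve_in X C \<and> C \<subseteq> \<Union>(S ` M)"
proof (rule ccontr)
  assume no: "\<not> ?thesis"
  \<comment> \<open>The end \<open>v\<close> of a chain lies on its last edge only, so an edge that leads on from \<open>v\<close> is a new one.\<close>
  define chain where "chain F u v \<longleftrightarrow> F \<subseteq> M \<and> arc_between X (\<Union>(S ` F)) u v \<and>
     (\<exists>e\<in>F. v \<in> V e \<and> (\<forall>e'\<in>F. v \<in> S e' \<longrightarrow> e' = e))" for F u v
  have "\<exists>F u v. card F = Suc n \<and> chain F u v" for n
  proof (induction n)
    case 0
    obtain e where "e \<in> M" using assms(3) by auto
    moreover then obtain u v where "V e = {u,v}" "arc_between X (S e) u v" using arcs by metis
    ultimately show ?case 
      by (intro exI[of _ "{e}"] exI[of _ u] exI[of _ v]) (auto simp: chain_def)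
  next
    case (Suc n)
    then obtain F u v where F: "card F = Suc n" "chain F u v" by auto
    then obtain e where e: "F \<subseteq> M" "arc_between X (\<Union>(S ` F)) u v" "e \<in> F" "v \<in> V e" "\<forall>e'\<in>F. v \<in> S e' \<longrightarrow> e' = e"
      by (auto simp: chain_def)
    obtain e' where e': "e' \<in> M" "e' \<noteq> e" "v \<in> S e'" using deg e by (metis subsetD)
    then have "e' \<notin> F" using e by auto
    have "v \<in> S e" using arcs[of e] e arc_between_subset by (metis insertE singletonD subsetD)
    have "e \<in> M" using e(1,3) by (rule subsetD)
    have "v \<in> V e \<inter> V e'"
      by (rule subsetD[OF meet[OF \<open>e \<in> M\<close> e'(1) e'(2)[symmetric]] IntI[OF \<open>v \<in> S e\<close> e'(3)]])
    then have ve': "v \<in> V e'" by (rule IntD2)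
    obtain w where w: "V e' = {v,w}" "v \<noteq> w" "arc_between X (S e') v w"
    proof -
      obtain p q where pq: "V e' = {p,q}" "p \<noteq> q" "arc_between X (S e') p q" using arcs e'(1) by metis
      from ve' pq(1) consider "v = p" | "v = q" by auto
      then show ?thesis
        by cases (use that[of q] that[of p] pq arc_between_sym[OF pq(3)] in \<open>auto simp: insert_commute\<close>)
    qed
    have int: "\<Union>(S ` F) \<inter> S e' \<subseteq> {v,w}" using meet e e' \<open>e' \<notin> F\<close> w(1) by blast
    have vF: "v \<in> \<Union>(S ` F)" using \<open>v \<in> S e\<close> e(3) by auto
    show ?case
    proof (cases "w \<in> \<Union>(S ` F)")
      case True
      obtain A' where A': "A' \<subseteq> \<Union>(S ` F)" "arc_between X A' w v"
        using arc_between_subarc[OF e(2) True] w(2) by metis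
      have "A' \<inter> S e' = {w,v}"
        using subset_trans[OF Int_mono[OF A'(1) order_refl] int] arc_between_subset[OF A'(2)] arc_between_subset[OF w(3)]
        by auto
      then have "simple_closed_curve_in X (A' \<union> S e')"
        using simple_closed_curve_two_arcs[OF assms(1) A'(2) arc_between_sym[OF w(3)]] by simp
      moreover have "A' \<union> S e' \<subseteq> \<Union>(S ` M)" using A' e(1) e'(1) by blast
      ultimately show ?thesis using no by blast
    next
      case False
      have "\<Union>(S ` F) \<inter> S e' = {v}"
      proof
        show "\<Union>(S ` F) \<inter> S e' \<subseteq> {v}"
        proof
          fix x assume x: "x \<in> \<Union>(S ` F) \<inter> S e'"
          then have "x \<noteq> w" using False by (metis IntD1)
          then show "x \<in> {v}" using subsetD[OF int x] by simp
        qed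
      qed (use vF e'(3) in simp)
      then have "arc_between X (\<Union>(S ` insert e' F)) u w" using arc_between_join[OF e(2) w(3)] by (simp add: Un_commute)
      moreover have "\<forall>e''\<in>insert e' F. w \<in> S e'' \<longrightarrow> e'' = e'" using False by auto
      ultimately have "chain (insert e' F) u w" unfolding chain_def
      proof (intro conjI bexI[of _ e'])
        show "insert e' F \<subseteq> M" using e(1) e'(1) by simp
        show "w \<in> V e'" using w(1) by simp
      qed simp_all
      moreover have "card (insert e' F) = Suc (Suc n)" using F(1) \<open>e' \<notin> F\<close> e(1) assms(2) by (simp add: finite_subset)
      ultimately show ?thesis by blast
    qed
  qed
  then obtain F where "card F = Suc (card M)" "F \<subseteq> M" unfolding chain_def by metis
  then show False using card_mono[OF assms(2), of F] by simp
qed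

section \<open>Segments in the plane\<close>

lemma plane_collinear:
  fixes d w :: "real^2"
  assumes "d \<noteq> 0" "vector [- d$2, d$1] \<bullet> w = 0"
  shows "w = ((d \<bullet> w) / (d \<bullet> d)) *\<^sub>R d"
proof -
  have dd: "d$1 * d$1 + d$2 * d$2 \<noteq> 0"
    using assms(1) by (simp add: vec_eq_iff forall_2 sum_squares_eq_zero_iff)
  have n: "d$1 * w$2 = d$2 * w$1" using assms(2) by (simp add: inner_vec_def sum_2)
  have 1: "w$1 * (d$1 * d$1 + d$2 * d$2) = (d$1 * w$1 + d$2 * w$2) * d$1"
    using n by (simp add: algebra_simps)
  have 2: "w$2 * (d$1 * d$1 + d$2 * d$2) = (d$1 * w$1 + d$2 * w$2) * d$2"
    using n by (simp add: algebra_simps)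
  show ?thesis using 1 2 dd by (simp add: vec_eq_iff forall_2 inner_vec_def sum_2 field_simps)
qed

text \<open>A small disc around an interior point of a segment meets it in a diameter, and the segment
lies in the closure of both open half discs.\<close>

lemma ball_split_by_segment:
  fixes a b z :: "real^2"
  assumes "z \<in> open_segment a b" "0 < r"
  obtains s H1 H2 where "0 < s" "s \<le> r" "convex H1" "convex H2" "H1 \<inter> closed_segment a b = {}"
    "H2 \<inter> closed_segment a b = {}" "ball z s = H1 \<union> H2 \<union> (ball z s \<inter> open_segment a b)"
    "ball z s \<inter> open_segment a b \<subseteq> closure H1" "ball z s \<inter> open_segment a b \<subseteq> closure H2"
proof -
  obtain u where u: "a \<noteq> b" "0 < u" "u < 1" "z = (1 - u) *\<^sub>R a + u *\<^sub>R b"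
    using assms(1) by (auto simp: in_segment)
  define d where "d = b - a"
  have "d \<noteq> 0" using u by (simp add: d_def)
  have z: "z = a + u *\<^sub>R d" using u by (simp add: d_def algebra_simps)
  define n :: "real^2" where "n = vector [- d$2, d$1]"
  have n0: "n \<noteq> 0" using \<open>d \<noteq> 0\<close> by (auto simp: n_def vec_eq_iff forall_2)
  have nd: "n \<bullet> d = 0" by (simp add: n_def inner_vec_def sum_2)
  \<comment> \<open>With this radius the ball around \<open>z\<close> contains neither end point of the segment.\<close>
  define s where "s = min r (min (u * norm d) ((1 - u) * norm d))"
  have s: "0 < s" "s \<le> r" using u assms \<open>d \<noteq> 0\<close> by (auto simp: s_def)
  define H where "H \<sigma> = ball z s \<inter> {y. \<sigma> * (n \<bullet> z) < (\<sigma> *\<^sub>R n) \<bullet> y}" for \<sigma> :: real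
  have conv: "convex (H \<sigma>)" for \<sigma>
  proof -
    show ?thesis unfolding H_def by (intro convex_Int convex_ball convex_halfspace_gt)
  qed
  have on_line: "n \<bullet> y = n \<bullet> z" if y: "y \<in> closed_segment a b" for y
  proof -
    obtain t where "y = (1 - t) *\<^sub>R a + t *\<^sub>R b" using y by (auto simp: in_segment)
    then have "y = a + t *\<^sub>R d" by (simp add: d_def algebra_simps)
    then show ?thesis using z nd by (simp add: inner_add_right)
  qed
  have disj: "H \<sigma> \<inter> closed_segment a b = {}" for \<sigma>
    using on_line by (auto simp: H_def)
  have line: "y \<in> open_segment a b" if y: "y \<in> ball z s" "n \<bullet> y = n \<bullet> z" for y
  proof -
    have "n \<bullet> (y - z) = 0" using y by (simp add: inner_diff_right)
    then obtain t where t: "y - z = t *\<^sub>R d" using plane_collinear[OF \<open>d \<noteq> 0\<close>] unfolding n_def by blast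
    have "\<bar>t\<bar> * norm d < s" using y(1) t by (metis dist_commute dist_norm mem_ball norm_scaleR)
    then have "\<bar>t\<bar> * norm d < u * norm d" "\<bar>t\<bar> * norm d < (1 - u) * norm d" by (auto simp: s_def)
    then have tt: "\<bar>t\<bar> < u" "\<bar>t\<bar> < 1 - u" using \<open>d \<noteq> 0\<close> by (auto simp: mult_less_cancel_right)
    have "y = a + (u + t) *\<^sub>R d" using t z by (simp add: algebra_simps)
    then have "y = (1 - (u + t)) *\<^sub>R a + (u + t) *\<^sub>R b" by (simp add: d_def algebra_simps)
    then show ?thesis using tt u(1) unfolding in_segment by (intro conjI exI[of _ "u + t"]) auto
  qed
  have split: "ball z s = H 1 \<union> H (-1) \<union> (ball z s \<inter> open_segment a b)"
    using line by (force simp: H_def)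
  have clo: "ball z s \<inter> open_segment a b \<subseteq> closure (H \<sigma>)" if \<sigma>: "\<sigma> = 1 \<or> \<sigma> = -1" for \<sigma>
  proof
    fix y assume y: "y \<in> ball z s \<inter> open_segment a b"
    then have ny: "n \<bullet> y = n \<bullet> z" using on_line segment_open_subset_closed by blast
    show "y \<in> closure (H \<sigma>)" unfolding closure_approachable
    proof (intro allI impI)
      fix e :: real assume "e > 0"
      obtain e' where e': "e' > 0" "ball y e' \<subseteq> ball z s" using y openE[OF open_ball] by (metis IntD1)
      define \<delta> where "\<delta> = min e e' / (2 * norm n)"
      have \<delta>: "\<delta> > 0" using \<open>e > 0\<close> e' n0 by (simp add: \<delta>_def)
      define x where "x = y + (\<sigma> * \<delta>) *\<^sub>R n"
      have "dist x y = \<delta> * norm n" using \<sigma> \<delta> by (auto simp: x_def dist_norm)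
      also have "\<dots> = min e e' / 2" using n0 by (simp add: \<delta>_def)
      finally have dxy: "dist x y < e" "dist x y < e'" using \<open>e > 0\<close> e' by auto
      have "\<sigma> * \<sigma> = 1" using \<sigma> by auto
      then have "(\<sigma> *\<^sub>R n) \<bullet> x = \<sigma> * (n \<bullet> z) + \<delta> * (n \<bullet> n)"
        using ny by (simp add: x_def inner_add_right algebra_simps)
      then have "x \<in> H \<sigma>" using e' dxy \<delta> n0 by (auto simp: H_def dist_commute subset_iff)
      then show "\<exists>x\<in>H \<sigma>. dist x y < e" using dxy by blast
    qed
  qed
  show ?thesis
    by (rule that[OF s conv conv disj disj split clo clo]) auto
qed

text \<open>As the segment leaves the ball, it removes a whole radius; the rest is star-shaped
about any point on the opposite radius.\<close>

lemma connected_ball_diff_segment: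
  fixes a b :: "'v::real_normed_vector"
  assumes "a \<noteq> b" "r \<le> norm (b - a)" "0 < r"
  shows "connected (ball a r - closed_segment a b)"
proof (rule starlike_imp_connected)
  define d where "d = b - a"
  have d: "d \<noteq> 0" using assms by (simp add: d_def)
  have seg: "x \<in> closed_segment a b \<longleftrightarrow> (\<exists>t. 0 \<le> t \<and> t \<le> 1 \<and> x = a + t *\<^sub>R d)" for x
  proof -
    have "(1 - t) *\<^sub>R a + t *\<^sub>R b = a + t *\<^sub>R d" for t by (simp add: d_def algebra_simps)
    then show ?thesis by (simp add: in_segment)
  qed
  have ray: "ball a r - closed_segment a b = ball a r - {a + t *\<^sub>R d | t. 0 \<le> t}"
  proof -
    have "t \<le> 1" if "0 \<le> t" "a + t *\<^sub>R d \<in> ball a r" for t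
    proof -
      have "t * norm d < r" using that by (simp add: dist_norm)
      then have "t * norm d < 1 * norm d" using assms(2) by (simp add: d_def)
      then show ?thesis using d by (simp add: mult_less_cancel_right)
    qed
    then show ?thesis using seg by blast
  qed
  define \<delta> where "\<delta> = r / (2 * norm d)"
  have \<delta>: "\<delta> > 0" "\<delta> * norm d < r" using d assms by (auto simp: \<delta>_def)
  let ?S = "ball a r - {a + t *\<^sub>R d | t. 0 \<le> t}"
  \<comment> \<open>The centre of the star lies opposite to the segment.\<close>
  define p where "p = a - \<delta> *\<^sub>R d"
  have pb: "p \<in> ball a r" using \<delta> by (simp add: p_def dist_norm)
  have pr: "p \<noteq> a + t *\<^sub>R d" if "0 \<le> t" for t
  proof
    assume "p = a + t *\<^sub>R d"
    then have "(t + \<delta>) *\<^sub>R d = 0" by (simp add: p_def algebra_simps)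
    then show False using d \<delta> that by simp
  qed
  have "closed_segment p x \<subseteq> ?S" if x: "x \<in> ?S" for x
  proof
    fix y assume y: "y \<in> closed_segment p x"
    then have yb: "y \<in> ball a r" using convex_ball pb x by (meson DiffD1 closed_segment_subset subsetD)
    obtain u where u: "0 \<le> u" "u \<le> 1" "y = (1 - u) *\<^sub>R p + u *\<^sub>R x" using y by (auto simp: in_segment)
    have "y \<noteq> a + t *\<^sub>R d" if t: "0 \<le> t" for t
    proof
      assume e: "y = a + t *\<^sub>R d"
      have "u \<noteq> 0" using u(3) e pr[OF t] by auto
      have "u *\<^sub>R x = a + t *\<^sub>R d - (1 - u) *\<^sub>R p" using u(3) e by (simp add: algebra_simps)
      also have "\<dots> = u *\<^sub>R a + (t + (1 - u) * \<delta>) *\<^sub>R d" by (simp add: p_def algebra_simps)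
      finally have "(1/u) *\<^sub>R (u *\<^sub>R x) = (1/u) *\<^sub>R (u *\<^sub>R a + (t + (1 - u) * \<delta>) *\<^sub>R d)" by simp
      then have "x = a + ((t + (1 - u) * \<delta>) / u) *\<^sub>R d"
        using \<open>u \<noteq> 0\<close> by (simp add: scaleR_add_right)
      moreover have "0 \<le> (t + (1 - u) * \<delta>) / u" using u t \<delta> by simp
      ultimately show False using x by blast
    qed
    then show "y \<in> ?S" using yb by blast
  qed
  moreover have "p \<in> ?S" using pb pr by blast
  ultimately show "starlike (ball a r - closed_segment a b)"
    unfolding ray starlike_def by blast
qed

section \<open>Segments in charts\<close>

text \<open>A segment in the surface is given by a chart together with the two end points of a straight
segment in the image of that chart.\<close>

definition seg_set :: "('a set \<times> ('a \<Rightarrow> real^2)) \<times> (real^2) \<times> (real^2) \<Rightarrow> 'a set" where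
  "seg_set = (\<lambda>(c, a, b). chart_inv c ` closed_segment a b)"

definition seg_interior :: "('a set \<times> ('a \<Rightarrow> real^2)) \<times> (real^2) \<times> (real^2) \<Rightarrow> 'a set" where
  "seg_interior = (\<lambda>(c, a, b). chart_inv c ` open_segment a b)"

definition seg_ends :: "('a set \<times> ('a \<Rightarrow> real^2)) \<times> (real^2) \<times> (real^2) \<Rightarrow> 'a set" where
  "seg_ends = (\<lambda>(c, a, b). {chart_inv c a, chart_inv c b})"

lemma compactin_simple_closed_curve: "simple_closed_curve_in X C \<Longrightarrow> compactin X C"
proof -
  assume "simple_closed_curve_in X C"
  then obtain \<gamma> where g: "embedding_map (top_of_set (sphere (0::complex) 1)) X \<gamma>" "C = \<gamma> ` sphere 0 1"
    by (auto simp: simple_closed_curve_in_def)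
  have "continuous_map (top_of_set (sphere (0::complex) 1)) X \<gamma>"
    using homeomorphic_imp_continuous_map[OF g(1)[unfolded embedding_map_def]]
    by (simp add: continuous_map_in_subtopology)
  then show ?thesis using g(2) image_compactin by (metis compactin_absolute compactin_euclidean_iff compact_sphere)
qed

context surface_atlas
begin

definition chart_segment :: "('a set \<times> ('a \<Rightarrow> real^2)) \<times> (real^2) \<times> (real^2) \<Rightarrow> bool" where
  "chart_segment = (\<lambda>(c, a, b). c \<in> \<A> \<and> a \<noteq> b \<and> closed_segment a b \<subseteq> chart_image c)"

lemma seg_set_decomp: "seg_set e = seg_interior e \<union> seg_ends e"
  by (cases e) (auto simp: seg_set_def seg_interior_def seg_ends_def closed_segment_eq_open)

lemma seg_interior_ends: "chart_segment e \<Longrightarrow> seg_interior e \<inter> seg_ends e = {}"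
proof (cases e)
  case (fields c a b)
  assume "chart_segment e"
  then have "closed_segment a b \<subseteq> chart_image c" by (simp add: chart_segment_def fields)
  then have "inj_on (chart_inv c) (closed_segment a b)" using inj_on_chart_inv inj_on_subset by blast
  then show ?thesis unfolding fields seg_interior_def seg_ends_def
    by (auto simp: inj_on_def open_segment_def)
qed

lemma compactin_seg_set: "chart_segment e \<Longrightarrow> compactin X (seg_set e)"
  by (cases e) (auto simp: chart_segment_def seg_set_def intro: compact_chart_inv_image)

lemma connectedin_seg_interior: "chart_segment e \<Longrightarrow> connectedin X (seg_interior e)"
proof (cases e)
  case (fields c a b)
  assume "chart_segment e"
  then have "c \<in> \<A>" "closed_segment a b \<subseteq> chart_image c" by (simp_all add: chart_segment_def fields)
  then show ?thesis unfolding fields seg_interior_def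
    using connected_chart_inv_image[of c "open_segment a b"] segment_open_subset_closed[of a b]
    by (auto simp: convex_connected)
qed

lemma closedin_seg_set: "chart_segment e \<Longrightarrow> closedin X (seg_set e)"
  using compactin_imp_closedin[OF hausdorff compactin_seg_set] .

lemma arc_between_seg_set:
  assumes "chart_segment e"
  shows "\<exists>u v. seg_ends e = {u, v} \<and> u \<noteq> v \<and> arc_between X (seg_set e) u v"
proof (cases e)
  case (fields c a b)
  have c: "c \<in> \<A>" "a \<noteq> b" "closed_segment a b \<subseteq> chart_image c"
    using assms by (simp_all add: chart_segment_def fields)
  define h where "h t = (1 - t) *\<^sub>R a + t *\<^sub>R b" for t
  have im: "h ` {0..1} = closed_segment a b" by (simp add: h_def closed_segment_image_interval)
  have inj: "inj_on (chart_inv c) (closed_segment a b)" using inj_on_chart_inv c(3) inj_on_subset by blast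
  have hinj: "inj_on h {0..1}"
  proof (rule inj_onI)
    fix s t assume "h s = h t"
    then have "(s - t) *\<^sub>R (b - a) = 0" by (simp add: h_def algebra_simps)
    then show "s = t" using c(2) by simp
  qed
  have "continuous_map (top_of_set {0..1}) X (\<lambda>t. chart_inv c (h t))"
    by (rule continuous_map_reparametrise[OF continuous_chart_inv[OF c(1)]])
      (use im c(3) in \<open>auto simp: h_def intro!: continuous_intros\<close>)
  moreover have "inj_on (\<lambda>t. chart_inv c (h t)) {0..1}"
    using comp_inj_on[OF hinj, of "chart_inv c"] inj im by (simp add: o_def)
  moreover have "(\<lambda>t. chart_inv c (h t)) ` {0..1} = seg_set e"
    using im by (simp add: fields seg_set_def image_image[symmetric, of "chart_inv c" h])
  moreover have "h 0 = a" "h 1 = b" by (simp_all add: h_def)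
  ultimately have "arc_between X (seg_set e) (chart_inv c a) (chart_inv c b)"
    unfolding arc_between_def by (intro exI[of _ "\<lambda>t. chart_inv c (h t)"]) auto
  moreover have "chart_inv c a \<noteq> chart_inv c b" using inj c(2) by (auto simp: inj_on_def)
  ultimately show ?thesis by (auto simp: fields seg_ends_def)
qed

text \<open>The set \<open>N\<close> is a disc around \<open>z\<close>; \<open>H1\<close> and \<open>H2\<close> are its two halves, the two local sides
of the segment.\<close>

lemma segment_two_sides:
  assumes "chart_segment e" "openin X W" "z \<in> W" "z \<in> seg_interior e"
  obtains N H1 H2 where "openin X N" "z \<in> N" "N \<subseteq> W" "connectedin X H1" "connectedin X H2"
    "H1 \<inter> seg_set e = {}" "H2 \<inter> seg_set e = {}" "N = H1 \<union> H2 \<union> (N \<inter> seg_interior e)"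
    "N \<inter> seg_interior e \<subseteq> X closure_of H1" "N \<inter> seg_interior e \<subseteq> X closure_of H2"
proof -
  obtain c a b where e: "e = (c, a, b)" by (cases e)
  have c: "c \<in> \<A>" "closed_segment a b \<subseteq> chart_image c"
    using assms by (simp_all add: chart_segment_def e)
  have os: "open_segment a b \<subseteq> chart_image c" using c(2) segment_open_subset_closed by blast
  obtain y where y: "y \<in> open_segment a b" "z = chart_inv c y" using assms(4) by (auto simp: e seg_interior_def)
  then have yc: "y \<in> chart_image c" using os by blast
  then have zc: "z \<in> fst c" "snd c z = y" using y(2) by (auto simp: chart_inv_in chart_chart_inv)
  obtain r where r: "r > 0" "ball y r \<subseteq> chart_image c" "chart_inv c ` ball y r \<subseteq> W"
    using chart_ball[OF c(1) assms(2,3) zc(1)] zc(2) by metis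
  obtain s H1 H2 where s: "0 < s" "s \<le> r" and conv: "convex H1" "convex H2"
    and disj: "H1 \<inter> closed_segment a b = {}" "H2 \<inter> closed_segment a b = {}"
    and split: "ball y s = H1 \<union> H2 \<union> (ball y s \<inter> open_segment a b)"
    and clo: "ball y s \<inter> open_segment a b \<subseteq> closure H1" "ball y s \<inter> open_segment a b \<subseteq> closure H2"
    using ball_split_by_segment[OF y(1) r(1)] by metis
  have B: "ball y s \<subseteq> chart_image c" "chart_inv c ` ball y s \<subseteq> W"
    using r s(2) subset_ball[OF s(2), of y] by blast+
  have H: "H1 \<subseteq> ball y s" "H2 \<subseteq> ball y s" using split by blast+
  have Hc: "H1 \<subseteq> chart_image c" "H2 \<subseteq> chart_image c" using H B(1) by (metis subset_trans)+
  have Nint: "chart_inv c ` ball y s \<inter> seg_interior e = chart_inv c ` (ball y s \<inter> open_segment a b)"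
    using inj_on_image_Int[OF inj_on_chart_inv B(1) os] by (simp add: e seg_interior_def)
  show ?thesis
  proof (rule that[of "chart_inv c ` ball y s" "chart_inv c ` H1" "chart_inv c ` H2"])
    show "openin X (chart_inv c ` ball y s)" using open_chart_inv_image[OF c(1) _ B(1)] by simp
    show "z \<in> chart_inv c ` ball y s" using y(2) s(1) by simp
    show "chart_inv c ` ball y s \<subseteq> W" by (rule B)
    show "connectedin X (chart_inv c ` H1)" "connectedin X (chart_inv c ` H2)"
      using connected_chart_inv_image[OF c(1)] conv convex_connected Hc by blast+
    show "chart_inv c ` H1 \<inter> seg_set e = {}" "chart_inv c ` H2 \<inter> seg_set e = {}"
      using inj_on_image_Int[OF inj_on_chart_inv Hc(1) c(2)] inj_on_image_Int[OF inj_on_chart_inv Hc(2) c(2)] disj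
      by (simp_all add: e seg_set_def)
    show "chart_inv c ` ball y s = chart_inv c ` H1 \<union> chart_inv c ` H2 \<union> (chart_inv c ` ball y s \<inter> seg_interior e)"
      unfolding Nint using split by (metis image_Un)
    show "chart_inv c ` ball y s \<inter> seg_interior e \<subseteq> X closure_of (chart_inv c ` H1)"
      "chart_inv c ` ball y s \<inter> seg_interior e \<subseteq> X closure_of (chart_inv c ` H2)"
      unfolding Nint
      using chart_inv_closure[OF c(1) Hc(1) subsetD[OF B(1)] subsetD[OF clo(1)]]
        chart_inv_closure[OF c(1) Hc(2) subsetD[OF B(1)] subsetD[OF clo(2)]] by blast+
  qed
qed

lemma seg_flip: "chart_segment (c, a, b) \<Longrightarrow> chart_segment (c, b, a)"
  "seg_set (c, a, b) = seg_set (c, b, a)" "seg_interior (c, a, b) = seg_interior (c, b, a)"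
  by (auto simp: chart_segment_def seg_set_def seg_interior_def closed_segment_commute open_segment_commute)

text \<open>At an end point there is only one local side: this is what excludes free ends in a minimal
separating graph.\<close>

lemma segment_end_neighbourhood:
  assumes "chart_segment e" "openin X W" "v \<in> W" "v \<in> seg_ends e"
  obtains N where "openin X N" "N \<subseteq> W" "connectedin X (N - seg_set e)" "N \<inter> seg_interior e \<noteq> {}"
proof -
  obtain c a b where e: "chart_segment (c, a, b)" "seg_set e = seg_set (c, a, b)" 
    "seg_interior e = seg_interior (c, a, b)" "v = chart_inv c a"
  proof -
    obtain c a b where "e = (c, a, b)" by (cases e)
    moreover then have "v = chart_inv c a \<or> v = chart_inv c b" using assms(4) by (auto simp: seg_ends_def)
    ultimately show ?thesis using that[of c a b] that[of c b a] assms(1) seg_flip by metis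
  qed
  have c: "c \<in> \<A>" "a \<noteq> b" "closed_segment a b \<subseteq> chart_image c"
    using e(1) by (simp_all add: chart_segment_def)
  have os: "open_segment a b \<subseteq> chart_image c" using c(3) segment_open_subset_closed by blast
  have ac: "a \<in> chart_image c" using c(3) by auto
  then have vc: "v \<in> fst c" "snd c v = a" using e(4) by (auto simp: chart_inv_in chart_chart_inv)
  obtain r0 where r0: "r0 > 0" "ball a r0 \<subseteq> chart_image c" "chart_inv c ` ball a r0 \<subseteq> W"
    using chart_ball[OF c(1) assms(2,3) vc(1)] vc(2) by metis
  define r where "r = min r0 (norm (b - a))"
  have r: "r > 0" "r \<le> norm (b - a)" "ball a r \<subseteq> chart_image c" "chart_inv c ` ball a r \<subseteq> W"
    using r0 c(2) subset_ball[of r r0 a] by (auto simp: r_def)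
  show ?thesis
  proof (rule that[of "chart_inv c ` ball a r"])
    show "openin X (chart_inv c ` ball a r)" using open_chart_inv_image[OF c(1) _ r(3)] by simp
    show "chart_inv c ` ball a r \<subseteq> W" by (rule r)
    have "chart_inv c ` ball a r - seg_set e = chart_inv c ` (ball a r - closed_segment a b)"
    proof -
      have "chart_inv c ` (ball a r - closed_segment a b) = chart_inv c ` ball a r - chart_inv c ` closed_segment a b"
        by (rule inj_on_image_set_diff[OF inj_on_chart_inv]) (use r(3) c(3) in auto)
      then show ?thesis unfolding e(2) by (simp add: seg_set_def)
    qed
    moreover have "connectedin X (chart_inv c ` (ball a r - closed_segment a b))"
      by (rule connected_chart_inv_image[OF c(1) connected_ball_diff_segment[OF c(2) r(2,1)]]) (use r(3) in blast)
    ultimately show "connectedin X (chart_inv c ` ball a r - seg_set e)" by simp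
    define t where "t = r / (2 * norm (b - a))"
    have t: "0 < t" "t < 1" "t * norm (b - a) < r" using r c(2) by (auto simp: t_def field_simps)
    let ?y = "(1 - t) *\<^sub>R a + t *\<^sub>R b"
    have "a - ?y = - (t *\<^sub>R (b - a))" by (simp add: algebra_simps)
    then have 1: "?y \<in> ball a r" using t by (simp add: dist_norm)
    have 2: "?y \<in> open_segment a b" using t c(2) by (auto simp: in_segment)
    have "chart_inv c ?y \<in> chart_inv c ` ball a r \<inter> seg_interior e"
      unfolding e(3) using 1 2 by (simp add: seg_interior_def)
    then show "chart_inv c ` ball a r \<inter> seg_interior e \<noteq> {}" by (metis empty_iff)
  qed
qed


section \<open>A minimal separating subgraph contains the curve\<close>

text \<open>The set \<open>V\<close> of all vertices is removed throughout, and only the edges are subject to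
minimality. Then an edge can be put back without its end points, and the components of \<open>p\<close> and \<open>q\<close>
are forced to meet across the interior of the edge.\<close>

lemma finite_graph_cut_curve:
  fixes p q :: 'a
  assumes U: "openin X U" "connectedin X U" and fin: "finite \<E>"
    and seg: "\<And>e. e \<in> \<E> \<Longrightarrow> chart_segment e"
    and sub: "\<And>e. e \<in> \<E> \<Longrightarrow> seg_set e \<subseteq> U"
    and meet: "\<And>e e'. e \<in> \<E> \<Longrightarrow> e' \<in> \<E> \<Longrightarrow> e \<noteq> e' \<Longrightarrow> seg_interior e \<inter> seg_set e' = {}"
    and pq: "p \<in> U" "q \<in> U" "p \<notin> \<Union>(seg_set ` \<E>)" "q \<notin> \<Union>(seg_set ` \<E>)"
    and sep: "\<not> joined_in X (U - \<Union>(seg_set ` \<E>)) p q"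
  obtains C where "simple_closed_curve_in X C" "C \<subseteq> \<Union>(seg_set ` \<E>)"
    "\<And>x. x \<in> U - C \<Longrightarrow> joined_in X (U - C) x p \<or> joined_in X (U - C) x q"
proof -
  define V where "V = \<Union>(seg_ends ` \<E>)"
  have finV: "finite V" unfolding V_def using fin by (auto simp: seg_ends_def)
  define R where "R M = U - V - \<Union>(seg_set ` M)" for M
  have ends: "seg_ends e \<subseteq> seg_set e" for e by (simp add: seg_set_decomp)
  have VE: "V \<subseteq> \<Union>(seg_set ` \<E>)" unfolding V_def by (rule UN_mono[OF order_refl ends])
  then have RE: "R \<E> = U - \<Union>(seg_set ` \<E>)" unfolding R_def by blast
  have pV: "p \<notin> V" "q \<notin> V" using pq VE by blast+
  have openR: "openin X (R M)" if "M \<subseteq> \<E>" for M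
  proof -
    have "finite M" using that fin finite_subset by blast
    then have "closedin X (\<Union>(seg_set ` M))" using that seg closedin_seg_set by (intro closedin_Union) auto
    then show ?thesis unfolding R_def using openin_diff_finite[OF U(1) finV] by (rule openin_diff[rotated])
  qed
  obtain M where M: "M \<subseteq> \<E>" "\<not> joined_in X (R M) p q"
    and minimal: "\<And>M'. M' \<subseteq> \<E> \<Longrightarrow> \<not> joined_in X (R M') p q \<Longrightarrow> card M \<le> card M'"
    using ex_has_least_nat[of "\<lambda>M. M \<subseteq> \<E> \<and> \<not> joined_in X (R M) p q" \<E> card] sep RE by auto
  have finM: "finite M" using M(1) fin finite_subset by blast
  have in_R: "s \<in> R M" if "s \<in> {p,q}" for s
    using that pq pV M(1) unfolding R_def by auto
  have join_off: "joined_in X (R (M - {e})) p q" if "e \<in> M" for e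
  proof (rule ccontr)
    assume "\<not> ?thesis"
    then have "card M \<le> card (M - {e})" using minimal M(1) by blast
    then show False using that finM by (metis card_Diff1_less leD)
  qed
  define A where "A s = component_in X (R M) s" for s
  have openA: "openin X (A s)" for s unfolding A_def using openin_component_in[OF openR[OF M(1)]] .
  have connA: "connectedin X (A s)" for s unfolding A_def by (rule connectedin_component_in)
  have subA: "A s \<subseteq> R M" for s unfolding A_def by (rule component_in_subset)
  have inA: "s \<in> A s" if "s \<in> {p,q}" for s
    unfolding A_def using joined_in_refl[OF in_R[OF that] openin_subset[OF openR[OF M(1)]]] by simp
  have disjA: "A p \<inter> A q = {}"
  proof (rule ccontr)
    assume "A p \<inter> A q \<noteq> {}"
    then have "A q \<subseteq> A p" unfolding A_def
      using component_in_absorb[OF connectedin_component_in component_in_subset] by (metis inf_commute)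
    then show False using inA[of q] M(2) by (auto simp: A_def)
  qed
  have absorb: "T \<subseteq> A s" if "connectedin X T" "T \<subseteq> R M" "T \<inter> A s \<noteq> {}" for T s
    using component_in_absorb that unfolding A_def by metis
  have interior_R: "seg_interior e \<subseteq> R (M - {e})" if e: "e \<in> M" for e
  proof -
    have eE: "e \<in> \<E>" using e M(1) by blast
    have "seg_interior e \<inter> seg_ends e' = {}" if "e' \<in> \<E>" for e'
      using meet[OF eE that] seg_interior_ends[OF seg[OF eE]] seg_set_decomp[of e'] by (cases "e = e'") auto
    moreover have "seg_interior e \<inter> seg_set e' = {}" if "e' \<in> M - {e}" for e'
      using meet[OF eE, of e'] that M(1) by auto
    moreover have "seg_interior e \<subseteq> U" using sub[OF eE] seg_set_decomp[of e] by simp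
    ultimately show ?thesis unfolding V_def R_def by blast
  qed
  have R_step: "R (M - {e}) - seg_set e = R M" if "e \<in> M" for e
    using that unfolding R_def by blast
  \<comment> \<open>A connected set from \<open>p\<close> to \<open>q\<close> that may cross \<open>e\<close> must leave the component of \<open>s\<close> there.\<close>
  have adh1: "\<exists>z \<in> seg_interior e. z \<in> X closure_of A s" if e: "e \<in> M" and s: "s \<in> {p,q}" for e s
  proof -
    obtain T where T: "connectedin X T" "T \<subseteq> R (M - {e})" "p \<in> T" "q \<in> T"
      using join_off[OF e] by (auto simp: joined_in_iff)
    have "T \<inter> A s \<noteq> {}" using T s inA by auto
    moreover have "T - A s \<noteq> {}" using T s inA[of p] inA[of q] disjA by auto
    ultimately obtain z where z: "z \<in> T" "z \<in> X frontier_of A s"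
      using connectedin_Int_frontier_of[OF T(1)] by blast
    then have zc: "z \<in> X closure_of A s" and "z \<notin> A s"
      using openA[of s] by (auto simp: frontier_of_def interior_of_openin)
    have "z \<notin> R M"
    proof
      assume zR: "z \<in> R M"
      let ?Z = "component_in X (R M) z"
      have "z \<in> ?Z" using joined_in_refl[OF zR openin_subset[OF openR[OF M(1)]]] by simp
      then have "?Z \<inter> A s \<noteq> {}" using zc openin_component_in[OF openR[OF M(1)], of z] by (auto simp: in_closure_of)
      then have "?Z \<subseteq> A s" using absorb[OF connectedin_component_in component_in_subset] by blast
      then show False using \<open>z \<in> ?Z\<close> \<open>z \<notin> A s\<close> by blast
    qed
    then have "z \<in> seg_set e" using z(1) T(2) R_step[OF e] by blast
    moreover have "z \<notin> V" using z(1) T(2) unfolding R_def by blast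
    then have "z \<notin> seg_ends e" using M(1) e unfolding V_def by auto
    ultimately have "z \<in> seg_interior e" using seg_set_decomp[of e] by simp
    then show ?thesis using zc by blast
  qed
  have sides: "\<exists>N H1 H2. openin X N \<and> z \<in> N \<and> N \<subseteq> R (M - {e}) \<and> connectedin X H1 \<and> connectedin X H2 \<and>
      H1 \<subseteq> R M \<and> H2 \<subseteq> R M \<and> N = H1 \<union> H2 \<union> (N \<inter> seg_interior e) \<and>
      N \<inter> seg_interior e \<subseteq> X closure_of H1 \<and> N \<inter> seg_interior e \<subseteq> X closure_of H2"
    if e: "e \<in> M" and z: "z \<in> seg_interior e" for e z
  proof -
    have "openin X (R (M - {e}))" using openR M(1) by blast
    then obtain N H1 H2 where N: "openin X N" "z \<in> N" "N \<subseteq> R (M - {e})" "connectedin X H1" "connectedin X H2"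
      "H1 \<inter> seg_set e = {}" "H2 \<inter> seg_set e = {}" "N = H1 \<union> H2 \<union> (N \<inter> seg_interior e)"
      "N \<inter> seg_interior e \<subseteq> X closure_of H1" "N \<inter> seg_interior e \<subseteq> X closure_of H2"
      using segment_two_sides[OF seg[OF subsetD[OF M(1) e]] _ subsetD[OF interior_R[OF e] z] z] by metis
    have "H1 \<subseteq> N" "H2 \<subseteq> N" using N(8) by blast+
    then have "H1 \<subseteq> R M" "H2 \<subseteq> R M" using N(3,6,7) R_step[OF e] by blast+
    with N show ?thesis by blast
  qed
  have off: "A s \<inter> seg_interior e = {}" if "e \<in> M" for e s
    using subA[of s] seg_set_decomp[of e] that unfolding R_def by auto
  have side_in: "(H1 \<subseteq> A s \<or> H2 \<subseteq> A s)"
    if "e \<in> M" "z \<in> X closure_of A s" "openin X N" "z \<in> N" "connectedin X H1" "connectedin X H2"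
      "H1 \<subseteq> R M" "H2 \<subseteq> R M" "N = H1 \<union> H2 \<union> (N \<inter> seg_interior e)" for e s z N H1 H2
  proof -
    have "N \<inter> A s \<noteq> {}" using that(2,3,4) by (auto simp: in_closure_of)
    then have "H1 \<inter> A s \<noteq> {} \<or> H2 \<inter> A s \<noteq> {}" using off[OF that(1), of s] that(9) by blast
    then show ?thesis using absorb that by metis
  qed
  \<comment> \<open>The edge is connected, and the points adherent to \<open>A s\<close> form a clopen part of it.\<close>
  have adh: "seg_interior e \<subseteq> X closure_of A s" if e: "e \<in> M" and s: "s \<in> {p,q}" for e s
  proof -
    let ?I = "seg_interior e" and ?D = "X closure_of A s"
    have "openin (subtopology X ?I) (?I \<inter> ?D)"
    proof (subst openin_subopen, intro ballI)
      fix z assume z: "z \<in> ?I \<inter> ?D"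
      then obtain N H1 H2 where N: "openin X N" "z \<in> N" "connectedin X H1" "connectedin X H2"
        "H1 \<subseteq> R M" "H2 \<subseteq> R M" "N = H1 \<union> H2 \<union> (N \<inter> ?I)"
        "N \<inter> ?I \<subseteq> X closure_of H1" "N \<inter> ?I \<subseteq> X closure_of H2"
        using sides[OF e, of z] by auto
      have "H1 \<subseteq> A s \<or> H2 \<subseteq> A s" using side_in[OF e _ N(1-7)] z by blast
      then have "N \<inter> ?I \<subseteq> ?D" using N(8,9) closure_of_mono by (metis subset_trans)
      then have "?I \<inter> N \<subseteq> ?I \<inter> ?D" by blast
      moreover have "openin (subtopology X ?I) (?I \<inter> N)" using N(1) by (simp add: openin_subtopology_Int2)
      ultimately show "\<exists>T. openin (subtopology X ?I) T \<and> z \<in> T \<and> T \<subseteq> ?I \<inter> ?D" using N(2) z by blast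
    qed
    moreover have "closedin (subtopology X ?I) (?I \<inter> ?D)" by (simp add: closedin_subtopology_Int_closed)
    moreover have "connected_space (subtopology X ?I)"
      using connectedin_seg_interior[OF seg] e M(1) connected_space_subtopology by blast
    moreover have "?I \<inter> ?D \<noteq> {}" using adh1[OF e s] by blast
    ultimately have "?I \<inter> ?D = topspace (subtopology X ?I)" by (auto simp: connected_space_clopen_in)
    then show ?thesis using interior_R[OF e] openin_subset[OF openR[of "M - {e}"]] M(1) by auto
  qed
  \<comment> \<open>At \<open>z\<close> each of the two disjoint components contains a local side, and there are only two sides.\<close>
  have nbhd: "\<exists>N. openin X N \<and> z \<in> N \<and> N \<subseteq> A p \<union> A q \<union> seg_interior e" if e: "e \<in> M" and z: "z \<in> seg_interior e" for e z
  proof -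
    obtain N H1 H2 where N: "openin X N" "z \<in> N" "connectedin X H1" "connectedin X H2"
      "H1 \<subseteq> R M" "H2 \<subseteq> R M" "N = H1 \<union> H2 \<union> (N \<inter> seg_interior e)"
      "N \<inter> seg_interior e \<subseteq> X closure_of H1" "N \<inter> seg_interior e \<subseteq> X closure_of H2"
      using sides[OF e z] by auto
    have "z \<in> X closure_of H1" "z \<in> X closure_of H2" using N z by auto
    then have ne: "H1 \<noteq> {}" "H2 \<noteq> {}" by auto
    have s: "H1 \<subseteq> A s \<or> H2 \<subseteq> A s" if "s \<in> {p,q}" for s
      using side_in[OF e _ N(1-7)] adh[OF e that] z by blast
    have "H1 \<subseteq> A p \<union> A q \<and> H2 \<subseteq> A p \<union> A q"
      using s[of p] s[of q] disjA ne by auto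
    then show ?thesis using N(1,2,7) by blast
  qed
  let ?I = "\<Union>(seg_interior ` M)"
  \<comment> \<open>The part \<open>O1\<close> is open because it contains both sides of each edge; \<open>O2\<close> collects all other components.\<close>
  have cover: "R M \<subseteq> A p \<union> A q"
  proof -
    define O1 where "O1 = A p \<union> A q \<union> ?I"
    define O2 where "O2 = R M - (A p \<union> A q)"
    have "openin X O1"
    proof (subst openin_subopen, intro ballI)
      fix z assume "z \<in> O1"
      then consider "z \<in> A p \<union> A q" | e where "e \<in> M" "z \<in> seg_interior e" unfolding O1_def by blast
      then show "\<exists>T. openin X T \<and> z \<in> T \<and> T \<subseteq> O1"
      proof cases
        case 1 then show ?thesis using openA[of p] openA[of q] by (intro exI[of _ "A p \<union> A q"]) (auto simp: O1_def)
      next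
        case 2
        then obtain N where N: "openin X N" "z \<in> N" "N \<subseteq> A p \<union> A q \<union> seg_interior e" using nbhd by blast
        have "seg_interior e \<subseteq> ?I" using 2(1) by blast
        then have "N \<subseteq> O1" using N(3) unfolding O1_def by blast
        then show ?thesis using N by blast
      qed
    qed
    moreover have "openin X O2"
    proof (subst openin_subopen, intro ballI)
      fix z assume z: "z \<in> O2"
      let ?Z = "component_in X (R M) z"
      have "z \<in> R M" using z by (simp add: O2_def)
      then have zZ: "z \<in> ?Z" using joined_in_refl[OF _ openin_subset[OF openR[OF M(1)]]] by simp
      have "?Z \<inter> A s = {}" if "s \<in> {p,q}" for s
      proof (rule ccontr)
        assume "?Z \<inter> A s \<noteq> {}"
        then have "?Z \<subseteq> A s" using absorb[OF connectedin_component_in component_in_subset] by blast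
        then show False using zZ z that by (auto simp: O2_def)
      qed
      from this[of p] this[of q] have "?Z \<subseteq> O2" using component_in_subset[of X "R M" z] unfolding O2_def by blast
      then show "\<exists>T. openin X T \<and> z \<in> T \<and> T \<subseteq> O2" using zZ openin_component_in[OF openR[OF M(1)]] by blast
    qed
    moreover have "connectedin X (U - V)" using connectedin_diff_finite[OF U finV] .
    moreover have "U - V \<subseteq> O1 \<union> O2"
    proof
      fix x assume x: "x \<in> U - V"
      show "x \<in> O1 \<union> O2"
      proof (cases "x \<in> R M")
        case False
        then obtain e where e: "e \<in> M" "x \<in> seg_set e" using x unfolding R_def by blast
        then have "x \<notin> seg_ends e" using x M(1) unfolding V_def by blast
        then have "x \<in> seg_interior e" using e(2) seg_set_decomp[of e] by simp
        then show ?thesis using e(1) unfolding O1_def by blast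
      qed (auto simp: O1_def O2_def)
    qed
    moreover have "O1 \<inter> O2 = {}"
    proof -
      have "seg_interior e \<inter> R M = {}" if "e \<in> M" for e
        using seg_set_decomp[of e] that unfolding R_def by auto
      then have "?I \<inter> R M = {}" by blast
      then show ?thesis unfolding O1_def O2_def by blast
    qed
    moreover have "(U - V) \<inter> O1 \<noteq> {}" using pq pV inA[of p] unfolding O1_def by auto
    ultimately have "(U - V) \<inter> O2 = {}" by (intro connectedin_open_split[of X "U - V" O1 O2]) auto
    then show ?thesis unfolding O2_def R_def by blast
  qed
  have "M \<noteq> {}"
  proof
    assume "M = {}"
    then have "R M = U - V" by (simp add: R_def)
    then have "joined_in X (R M) p q"
      using connectedin_diff_finite[OF U finV] pq pV by (auto simp: joined_in_iff)
    then show False using M(2) by blast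
  qed
  have "\<exists>C. simple_closed_curve_in X C \<and> C \<subseteq> \<Union>(seg_set ` M)"
  proof (rule graph_contains_simple_closed_curve[where V = seg_ends])
    show "\<exists>u v. seg_ends e = {u, v} \<and> u \<noteq> v \<and> arc_between X (seg_set e) u v" if "e \<in> M" for e
      using arc_between_seg_set seg that M(1) by blast
    show "seg_set e \<inter> seg_set e' \<subseteq> seg_ends e \<inter> seg_ends e'" if "e \<in> M" "e' \<in> M" "e \<noteq> e'" for e e'
      using meet[of e e'] meet[of e' e] that M(1) seg_set_decomp[of e] seg_set_decomp[of e'] by blast
    show "\<exists>e'\<in>M. e' \<noteq> e \<and> v \<in> seg_set e'" if e: "e \<in> M" and v: "v \<in> seg_ends e" for e v
    proof (rule ccontr)
      assume no: "\<not> ?thesis"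
      have eE: "e \<in> \<E>" using e M(1) by blast
      define W where "W = U - (V - {v}) - \<Union>(seg_set ` (M - {e}))"
      have "closedin X (\<Union>(seg_set ` (M - {e})))" using M(1) finM seg closedin_seg_set by (intro closedin_Union) auto
      then have "openin X W" unfolding W_def
        using openin_diff[OF openin_diff_finite[OF U(1), of "V - {v}"]] finV by simp
      moreover have "v \<in> W"
      proof -
        have "v \<in> U" using subsetD[OF sub[OF eE] subsetD[OF ends v]] .
        then show ?thesis using no unfolding W_def by auto
      qed
      ultimately obtain N where N: "openin X N" "N \<subseteq> W" "connectedin X (N - seg_set e)" "N \<inter> seg_interior e \<noteq> {}"
        using segment_end_neighbourhood[OF seg[OF eE] _ _ v] by blast
      have vs: "v \<in> seg_set e" using subsetD[OF ends v] .
      then have NR: "N - seg_set e \<subseteq> R M" using N(2) unfolding W_def R_def by blast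
      obtain z where z: "z \<in> N" "z \<in> seg_interior e" using N(4) by blast
      have meets: "(N - seg_set e) \<inter> A s \<noteq> {}" if "s \<in> {p,q}" for s
      proof -
        have "z \<in> X closure_of A s" using adh[OF e that] z(2) by blast
        then obtain y where y: "y \<in> A s" "y \<in> N" using N(1) z(1) by (auto simp: in_closure_of)
        moreover have "y \<notin> seg_set e" using subA[of s] y(1) e unfolding R_def by blast
        ultimately show ?thesis by blast
      qed
      then have "N - seg_set e \<subseteq> A s" if "s \<in> {p,q}" for s using absorb[OF N(3) NR] that by blast
      from this[of p] this[of q] meets[of p] show False using disjA by blast
    qed
  qed (use hausdorff finM \<open>M \<noteq> {}\<close> in auto)
  then obtain C where C: "simple_closed_curve_in X C" "C \<subseteq> \<Union>(seg_set ` M)" by blast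
  show ?thesis
  proof (rule that[OF C(1)])
    show "C \<subseteq> \<Union>(seg_set ` \<E>)" using C(2) M(1) by blast
    have openUC: "openin X (U - C)"
      using compactin_imp_closedin[OF hausdorff compactin_simple_closed_curve[OF C(1)]] U(1) by (rule openin_diff[rotated])
    have AU: "A s \<subseteq> U - C" for s using subA[of s] C(2) unfolding R_def by blast
    fix x assume x: "x \<in> U - C"
    let ?D = "component_in X (U - C) x"
    have "x \<in> ?D" using joined_in_refl[OF x openin_subset[OF openUC]] by simp
    then have "infinite ?D" using openin_infinite[OF openin_component_in[OF openUC]] by blast
    then have "\<not> ?D \<subseteq> V" using finite_subset[OF _ finV] by metis
    then obtain y where y: "y \<in> ?D" "y \<notin> V" by (meson subsetI)
    have "?D \<inter> A p \<noteq> {} \<or> ?D \<inter> A q \<noteq> {}"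
    proof (cases "y \<in> R M")
      case True then show ?thesis using cover y(1) by blast
    next
      case False
      have "y \<in> U" using y(1) component_in_subset[of X "U - C" x] by blast
      then obtain e where e: "e \<in> M" "y \<in> seg_set e" using False y(2) unfolding R_def by blast
      then have "y \<notin> seg_ends e" using y(2) M(1) unfolding V_def by blast
      then have "y \<in> seg_interior e" using e(2) seg_set_decomp[of e] by simp
      then have "y \<in> X closure_of A p" using adh[OF e(1), of p] by blast
      then show ?thesis using y(1) openin_component_in[OF openUC, of x] unfolding in_closure_of by blast
    qed
    then have "A p \<subseteq> ?D \<or> A q \<subseteq> ?D"
      using component_in_absorb[OF connA AU] by (metis inf_commute)
    then show "joined_in X (U - C) x p \<or> joined_in X (U - C) x q" using inA[of p] inA[of q] by auto
  qed
qed
end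

section \<open>General position by one-dimensional Sard\<close>

text \<open>Sard's theorem for functions of one real variable; the values are regarded as vectors of
length one, because \<open>baby_Sard\<close> is about maps between spaces of vectors.\<close>

lemma negligible_critical_values:
  fixes q :: "real \<Rightarrow> real"
  assumes "\<And>t. t \<in> S \<Longrightarrow> (q has_real_derivative 0) (at t)"
  shows "negligible ((\<lambda>t. vec (q t) :: real^1) ` S)"
proof -
  let ?f = "\<lambda>x::real^1. vec (q (x$1)) :: real^1"
  have "negligible (?f ` (vec ` S))"
  proof (rule baby_Sard[where f' = "\<lambda>_ _. 0"])
    fix x :: "real^1" assume "x \<in> vec ` S"
    then have "(q has_derivative (\<lambda>_. 0)) (at (x$1))"
      using assms by (auto simp: has_field_derivative_def lambda_zero[symmetric])
    then have "((q \<circ> (\<lambda>x::real^1. x$1)) has_derivative ((\<lambda>_. 0) \<circ> (\<lambda>x::real^1. x$1))) (at x)"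
      by (intro diff_chain_at bounded_linear_imp_has_derivative bounded_linear_vec_nth)
    then have "((\<lambda>x::real^1. q (x$1)) has_derivative (\<lambda>_. 0)) (at x)" by (simp add: o_def)
    then have "(?f has_derivative (\<lambda>_. 0)) (at x)"
      by (subst has_derivative_componentwise_within) (auto simp: Basis_vec_def inner_axis)
    then show "(?f has_derivative (\<lambda>_. 0)) (at x within vec ` S)" by (rule has_derivative_at_withinI)
    show "rank (matrix (\<lambda>_::real^1. 0::real^1)) < CARD(1)"
      by (simp add: matrix_def rank_0 flip: zero_vec_def)
  qed simp
  then show ?thesis by (simp add: image_image)
qed

lemma derivative_zero_of_accumulating_level:
  fixes q :: "real \<Rightarrow> real"
  assumes "t islimpt {x. q x = s}" "q differentiable (at t)"
  shows "q t = s \<and> (q has_real_derivative 0) (at t)"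
proof -
  obtain D where D: "(q has_real_derivative D) (at t)" using assms(2) by (auto simp: real_differentiable_def)
  obtain x where x: "\<And>n::nat. x n \<in> {x. q x = s} - {t}" "x \<longlonglongrightarrow> t"
    using assms(1) by (auto simp: islimpt_sequential)
  have at: "filterlim x (at t) sequentially"
    using x by (auto simp: filterlim_at)
  have "isCont q t" using D by (rule DERIV_isCont)
  then have "(\<lambda>n. q (x n)) \<longlonglongrightarrow> q t" using x(2) by (rule isCont_tendsto_compose)
  moreover have "(\<lambda>n. q (x n)) = (\<lambda>_. s)" using x(1) by auto
  ultimately have qt: "q t = s" by (simp add: LIMSEQ_const_iff)
  have "((\<lambda>y. (q y - q t) / (y - t)) \<longlongrightarrow> D) (at t)" using D by (simp add: has_field_derivative_iff)
  then have "(\<lambda>n. (q (x n) - q t) / (x n - t)) \<longlonglongrightarrow> D" using at by (rule filterlim_compose)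
  moreover have "(\<lambda>n. (q (x n) - q t) / (x n - t)) = (\<lambda>_. 0)" using x(1) qt by auto
  ultimately have "D = 0" by (simp add: LIMSEQ_const_iff)
  then show ?thesis using D qt by simp
qed

context surface_atlas
begin

lemma differentiable_transition:
  assumes "c \<in> \<A>" "c' \<in> \<A>" "y \<in> chart_image c'" "chart_inv c' y \<in> fst c"
  shows "(\<lambda>y. snd c (chart_inv c' y)) differentiable (at y)"
proof -
  have "\<forall>(V, \<phi>)\<in>\<A>. \<forall>(W, \<psi>)\<in>\<A>. smooth_on (\<psi> \<circ> inv_into V \<phi>) (\<phi> ` (V \<inter> W))"
    using atlas by (simp add: smooth_atlas_def)
  then have "smooth_on (snd c \<circ> inv_into (fst c') (snd c')) (snd c' ` (fst c' \<inter> fst c))"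
    using assms(1,2) by (metis (mono_tags, lifting) case_prod_conv prod.collapse)
  then have "Ck_on (Suc 0) (snd c \<circ> chart_inv c') (snd c' ` (fst c' \<inter> fst c))"
    unfolding smooth_on_def chart_inv_def by blast
  moreover have "y \<in> snd c' ` (fst c' \<inter> fst c)"
    using assms chart_inv_in chart_chart_inv by (metis IntI image_eqI)
  ultimately have "(snd c \<circ> chart_inv c') differentiable (at y)" unfolding Ck_on.simps by (metis (no_types))
  then show ?thesis by (simp add: o_def)
qed

text \<open>Along the segment, the \<open>j\<close>-th coordinate of the other chart is a differentiable function \<open>q\<close>
of one variable. If infinitely many points of the segment have the same coordinate \<open>s\<close>, they accumulate on the
segment, and at the accumulation point \<open>q\<close> has value \<open>s\<close> and derivative zero. So \<open>s\<close> is a critical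
value.\<close>

lemma negligible_infinite_intersections:
  assumes c: "c \<in> \<A>" "compact B" "B \<subseteq> chart_image c" and c': "c' \<in> \<A>" "closed_segment a b \<subseteq> chart_image c'"
  shows "negligible {v::real^1. infinite (chart_inv c' ` closed_segment a b \<inter> chart_inv c ` {y \<in> B. y$j = v$1})}"
proof -
  define h where "h t = (1 - t) *\<^sub>R a + t *\<^sub>R b" for t
  have im: "h ` {0..1} = closed_segment a b" by (simp add: h_def closed_segment_image_interval)
  have hin: "h t \<in> chart_image c'" if "t \<in> {0..1}" for t using im c'(2) that by blast
  define q where "q t = snd c (chart_inv c' (h t)) $ j" for t
  define T where "T = {t \<in> {0..1}. chart_inv c' (h t) \<in> chart_inv c ` B}"
  have cont: "continuous_map (top_of_set {0..1}) X (\<lambda>t. chart_inv c' (h t))"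
    by (rule continuous_map_reparametrise[OF continuous_chart_inv[OF c'(1)]])
      (use hin in \<open>auto simp: h_def intro!: continuous_intros\<close>)
  have "closedin X (chart_inv c ` B)"
    using compactin_imp_closedin[OF hausdorff compact_chart_inv_image[OF c]] .
  then have "closedin (top_of_set {0..1}) T"
    using closedin_continuous_map_preimage[OF cont] by (simp add: T_def)
  then have closedT: "closed T" by (simp add: closedin_closed_eq)
  have Tfst: "chart_inv c' (h t) \<in> fst c" if "t \<in> T" for t
  proof -
    obtain y where "y \<in> B" "chart_inv c' (h t) = chart_inv c y" using \<open>t \<in> T\<close> unfolding T_def by auto
    then show ?thesis using chart_inv_in[of y c] c(3) by auto
  qed
  have diff: "q differentiable (at t)" if t: "t \<in> T" for t
  proof -
    have 1: "(\<lambda>y. snd c (chart_inv c' y)) differentiable (at (h t))"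
      using differentiable_transition[OF c(1) c'(1)] hin Tfst[OF t] t unfolding T_def by blast
    have "h differentiable (at t)" unfolding h_def by (intro derivative_intros)
    then have "((\<lambda>y. snd c (chart_inv c' y)) \<circ> h) differentiable (at t)" using differentiable_chain_at 1 by blast
    then have "(\<lambda>t. snd c (chart_inv c' (h t))) differentiable (at t)" by (simp add: o_def)
    then obtain D where "((\<lambda>t. snd c (chart_inv c' (h t))) has_derivative D) (at t)" by (auto simp: differentiable_def)
    then have "(q has_derivative (\<lambda>x. D x $ j)) (at t)" unfolding q_def by (rule bounded_linear.has_derivative[OF bounded_linear_vec_nth])
    then show ?thesis by (auto simp: differentiable_def)
  qed
  define S where "S = {t \<in> T. (q has_real_derivative 0) (at t)}"
  have "{v::real^1. infinite (chart_inv c' ` closed_segment a b \<inter> chart_inv c ` {y \<in> B. y$j = v$1})}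
    \<subseteq> (\<lambda>t. vec (q t)) ` S"
  proof
    fix v :: "real^1" assume "v \<in> {v. infinite (chart_inv c' ` closed_segment a b \<inter> chart_inv c ` {y \<in> B. y$j = v$1})}"
    then have inf: "infinite (chart_inv c' ` closed_segment a b \<inter> chart_inv c ` {y \<in> B. y$j = v$1})" by simp
    define Z where "Z = {t \<in> T. q t = v$1}"
    have "chart_inv c' ` closed_segment a b \<inter> chart_inv c ` {y \<in> B. y$j = v$1} \<subseteq> (\<lambda>t. chart_inv c' (h t)) ` Z"
    proof
      fix x assume x: "x \<in> chart_inv c' ` closed_segment a b \<inter> chart_inv c ` {y \<in> B. y$j = v$1}"
      then obtain t where t: "t \<in> {0..1}" "x = chart_inv c' (h t)" unfolding im[symmetric] by blast
      obtain y where y: "y \<in> B" "y$j = v$1" "x = chart_inv c y" using x by blast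
      have "snd c x = y" using chart_chart_inv y c(3) by blast
      moreover have "x \<in> chart_inv c ` B" using y(1,3) by simp
      ultimately have "t \<in> Z" using t y(2) unfolding Z_def T_def q_def by simp
      then show "x \<in> (\<lambda>t. chart_inv c' (h t)) ` Z" using t(2) by blast
    qed
    from finite_subset[OF this finite_imageI] have "infinite Z" using inf by blast
    moreover have "Z \<subseteq> {0..1}" unfolding Z_def T_def by blast
    ultimately obtain t where t: "t islimpt Z"
      using Heine_Borel_imp_Bolzano_Weierstrass[of "{0..1::real}" Z] by auto
    have "t islimpt T" by (rule islimpt_subset[OF t]) (auto simp: Z_def)
    then have "t \<in> T" using closedT closed_limpt by blast
    moreover have "t islimpt {x. q x = v$1}" by (rule islimpt_subset[OF t]) (auto simp: Z_def)
    ultimately have "q t = v$1 \<and> (q has_real_derivative 0) (at t)"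
      using derivative_zero_of_accumulating_level diff by blast
    then have "t \<in> S" "v = vec (q t)" using \<open>t \<in> T\<close> by (auto simp: S_def vec_eq_iff)
    then show "v \<in> (\<lambda>t. vec (q t)) ` S" by blast
  qed
  moreover have "negligible ((\<lambda>t. vec (q t) :: real^1) ` S)" by (rule negligible_critical_values) (simp add: S_def)
  ultimately show ?thesis by (rule negligible_subset[rotated])
qed

end

definition wall :: "('a set \<times> ('a \<Rightarrow> real^2)) \<Rightarrow> real^2 \<Rightarrow> real^2 \<Rightarrow> 2 \<Rightarrow> real \<Rightarrow> 'a set" where
  "wall c l u j s = chart_inv c ` {y \<in> cbox l u. y$j = s}"

lemma box_slice_eq_segment:
  fixes l u :: "real^2"
  assumes "l$j \<le> s" "s \<le> u$j" "\<And>i. l$i \<le> u$i"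
  shows "{y \<in> cbox l u. y$j = s} = closed_segment (\<chi> i. if i = j then s else l$i) (\<chi> i. if i = j then s else u$i)"
    (is "_ = closed_segment ?a ?b")
proof (intro equalityI subsetI)
  fix y assume "y \<in> {y \<in> cbox l u. y$j = s}"
  then have y: "\<And>i. l$i \<le> y$i \<and> y$i \<le> u$i" "y$j = s" by (auto simp: mem_box_cart)
  obtain k where k: "k \<noteq> j" "\<And>i. i = j \<or> i = k" using exhaust_2 by (metis one_neq_zero zero_neq_one)
  have "y$k \<in> closed_segment (l$k) (u$k)" using y(1)[of k] assms(3)[of k] by (simp add: closed_segment_eq_real_ivl)
  then obtain t where t: "0 \<le> t" "t \<le> 1" "y$k = (1 - t) * l$k + t * u$k" by (auto simp: in_segment)
  have "y = (1 - t) *\<^sub>R ?a + t *\<^sub>R ?b"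
  proof (subst vec_eq_iff, intro allI)
    fix i
    show "y$i = ((1 - t) *\<^sub>R ?a + t *\<^sub>R ?b)$i"
    proof (cases "i = j")
      case True then show ?thesis using y(2) by (simp add: algebra_simps)
    next
      case False then have "i = k" using k(2) by metis
      then show ?thesis using t(3) k(1) by simp
    qed
  qed
  then show "y \<in> closed_segment ?a ?b" using t by (auto simp: in_segment)
next
  fix y assume "y \<in> closed_segment ?a ?b"
  then obtain t where t: "0 \<le> t" "t \<le> 1" "y = (1 - t) *\<^sub>R ?a + t *\<^sub>R ?b" by (auto simp: in_segment)
  have yj: "y$j = s" unfolding t(3) by (simp add: algebra_simps)
  have "l$i \<le> y$i \<and> y$i \<le> u$i" for i
  proof (cases "i = j")
    case True then show ?thesis using yj assms(1,2) by simp
  next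
    case False
    have "y$i \<in> closed_segment (l$i) (u$i)" using t False by (auto simp: in_segment)
    then show ?thesis using assms(3)[of i] by (simp add: closed_segment_eq_real_ivl)
  qed
  then show "y \<in> {y \<in> cbox l u. y$j = s}" using yj by (simp add: mem_box_cart)
qed

context surface_atlas
begin

text \<open>The positions of the walls are chosen one after the other, each in its own
interval \<open>{lo i<..<hi i}\<close>, avoiding the finitely many negligible sets that belong to the walls already placed.\<close>

lemma generic_walls:
  fixes c :: "'i \<Rightarrow> 'a set \<times> ('a \<Rightarrow> real^2)" and l u :: "'i \<Rightarrow> real^2" and j :: "'i \<Rightarrow> 2"
  assumes "finite I" and c: "\<And>i. i \<in> I \<Longrightarrow> c i \<in> \<A> \<and> cbox (l i) (u i) \<subseteq> chart_image (c i)"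
    and lu: "\<And>i k. i \<in> I \<Longrightarrow> l i $ k \<le> u i $ k"
    and lohi: "\<And>i. i \<in> I \<Longrightarrow> lo i < hi i \<and> l i $ j i \<le> lo i \<and> hi i \<le> u i $ j i"
  shows "\<exists>s. (\<forall>i\<in>I. lo i < s i \<and> s i < hi i) \<and> (\<forall>i\<in>I. \<forall>k\<in>I. i \<noteq> k \<longrightarrow>
    finite (wall (c i) (l i) (u i) (j i) (s i) \<inter> wall (c k) (l k) (u k) (j k) (s k)))"
  using assms
proof (induction I)
  case empty then show ?case by simp
next
  case (insert i I)
  let ?w = "\<lambda>i t. wall (c i) (l i) (u i) (j i) t"
  from insert obtain s where s: "\<forall>i\<in>I. lo i < s i \<and> s i < hi i"
    "\<forall>i\<in>I. \<forall>k\<in>I. i \<noteq> k \<longrightarrow> finite (?w i (s i) \<inter> ?w k (s k))" by auto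
  have "negligible {v::real^1. infinite (?w k (s k) \<inter> ?w i (v$1))}" if k: "k \<in> I" for k
  proof -
    have ck: "c k \<in> \<A>" "cbox (l k) (u k) \<subseteq> chart_image (c k)" using insert.prems(1)[of k] k by auto
    have ci: "c i \<in> \<A>" "cbox (l i) (u i) \<subseteq> chart_image (c i)" using insert.prems(1)[of i] by auto
    have "lo k < s k" "s k < hi k" "l k $ j k \<le> lo k" "hi k \<le> u k $ j k" "\<And>i. l k $ i \<le> u k $ i"
      using s(1) k insert.prems(2,3)[of k] by simp_all
    then obtain a b where ab: "{y \<in> cbox (l k) (u k). y$(j k) = s k} = closed_segment a b"
      using box_slice_eq_segment[of "l k" "j k" "s k" "u k"] by auto
    have "closed_segment a b \<subseteq> chart_image (c k)" using ab ck(2) by blast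
    then show ?thesis unfolding wall_def ab
      using negligible_infinite_intersections[OF ci(1) compact_cbox ci(2) ck(1)] by blast
  qed
  then have "negligible (\<Union>k\<in>I. {v::real^1. infinite (?w k (s k) \<inter> ?w i (v$1))})"
    using insert.hyps(1) by (intro negligible_Union) auto
  moreover have "\<not> negligible (box (vec (lo i)) (vec (hi i)) :: (real^1) set)"
    using insert.prems(3)[of i] by (intro open_not_negligible open_box) (auto simp: interval_eq_empty_cart)
  ultimately obtain v :: "real^1" where v: "v \<in> box (vec (lo i)) (vec (hi i))"
    "v \<notin> (\<Union>k\<in>I. {v::real^1. infinite (?w k (s k) \<inter> ?w i (v$1))})"
    using negligible_subset by (metis (no_types, lifting) subsetI)
  let ?s = "s(i := v$1)"
  have same: "?s k = s k" if "k \<in> I" for k using that insert.hyps(2) by auto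
  have "\<forall>k\<in>insert i I. lo k < ?s k \<and> ?s k < hi k"
    using s(1) v(1) same by (auto simp: mem_box_cart)
  moreover have "finite (?w k (?s k) \<inter> ?w k' (?s k'))"
    if kk: "k \<in> insert i I" "k' \<in> insert i I" "k \<noteq> k'" for k k'
  proof -
    consider "k \<in> I" "k' \<in> I" | "k = i" "k' \<in> I" | "k \<in> I" "k' = i" using kk by auto
    then show ?thesis
    proof cases
      case 1 then show ?thesis using s(2) same kk(3) by simp
    next
      case 2 then show ?thesis using v(2) same[of k'] by (simp add: Int_commute)
    next
      case 3 then show ?thesis using v(2) same[of k] by simp
    qed
  qed
  ultimately show ?case by (intro exI[of _ ?s]) blast
qed

end

section \<open>Subdivision into a graph\<close>

lemma consecutive_in_finite_set:
  fixes T :: "real set"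
  assumes "finite T" "0 \<in> T" "1 \<in> T" "x \<in> {0..1}"
  obtains t t' where "t \<in> T" "t' \<in> T" "t < t'" "T \<inter> {t<..<t'} = {}" "x \<in> {t..t'}"
proof (cases "x = 1")
  case False
  define t where "t = Max {s\<in>T. s \<le> x}"
  define t' where "t' = Min {s\<in>T. x < s}"
  have "{s\<in>T. s \<le> x} \<noteq> {}" "{s\<in>T. x < s} \<noteq> {}" using assms False by auto
  then have "t \<in> {s\<in>T. s \<le> x}" "t' \<in> {s\<in>T. x < s}"
    unfolding t_def t'_def using assms(1) by (intro Max_in Min_in; simp)+
  moreover have "s \<le> t \<or> t' \<le> s" if "s \<in> T" for s
    unfolding t_def t'_def using assms(1) that by (cases "s \<le> x") auto
  ultimately show ?thesis using that[of t t'] by force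
next
  case True
  define t where "t = Max {s\<in>T. s < 1}"
  have "{s\<in>T. s < 1} \<noteq> {}" using assms by auto
  then have "t \<in> {s\<in>T. s < 1}"
    unfolding t_def using assms(1) by (intro Max_in; simp)
  moreover have "s \<le> t \<or> 1 \<le> s" if "s \<in> T" for s
    unfolding t_def using assms(1) that by (cases "s < 1") auto
  ultimately show ?thesis using that[of t 1] assms(3) True by force
qed

lemma segment_subinterval:
  fixes a b :: "'v::real_vector"
  assumes "a \<noteq> b" "t < t'"
  defines "h \<equiv> \<lambda>t. (1 - t) *\<^sub>R a + t *\<^sub>R b"
  shows "closed_segment (h t) (h t') = h ` {t..t'}" "open_segment (h t) (h t') = h ` {t<..<t'}"
    "h t \<noteq> h t'"
proof -
  have inj: "inj h"
  proof (rule injI)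
    fix s r assume "h s = h r"
    then have "(s - r) *\<^sub>R (b - a) = 0" by (simp add: h_def algebra_simps)
    then show "s = r" using assms(1) by simp
  qed
  have aff: "(1 - u) *\<^sub>R h t + u *\<^sub>R h t' = h ((1 - u) * t + u * t')" for u
    unfolding h_def by (simp add: algebra_simps)
  show "closed_segment (h t) (h t') = h ` {t..t'}"
  proof -
    have "closed_segment (h t) (h t') = (\<lambda>u. h ((1 - u) * t + u * t')) ` {0..1}"
      by (simp add: closed_segment_image_interval aff)
    also have "\<dots> = h ` closed_segment t t'" by (simp add: closed_segment_image_interval image_image)
    finally show ?thesis using assms(2) by (simp add: closed_segment_eq_real_ivl)
  qed
  then show "open_segment (h t) (h t') = h ` {t<..<t'}"
  proof -
    assume *: "closed_segment (h t) (h t') = h ` {t..t'}"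
    have "open_segment (h t) (h t') = h ` {t..t'} - h ` {t, t'}" by (simp add: open_segment_def *)
    also have "\<dots> = h ` ({t..t'} - {t, t'})" using image_set_diff[OF inj] by metis
    also have "{t..t'} - {t, t'} = {t<..<t'}" using assms(2) by auto
    finally show ?thesis .
  qed
  show "h t \<noteq> h t'" using inj assms(2) by (metis injD less_irrefl)
qed

context surface_atlas
begin

text \<open>The segments are cut at their end points and at all their mutual intersections, finitely many
points \<open>P\<close>. The pieces between consecutive cuts are the edges of a graph.\<close>

lemma subdivide_segments:
  fixes e :: "'i \<Rightarrow> ('a set \<times> ('a \<Rightarrow> real^2)) \<times> (real^2) \<times> (real^2)"
  assumes "finite I" and seg: "\<And>i. i \<in> I \<Longrightarrow> chart_segment (e i)"
    and fin: "\<And>i k. i \<in> I \<Longrightarrow> k \<in> I \<Longrightarrow> i \<noteq> k \<Longrightarrow> finite (seg_set (e i) \<inter> seg_set (e k))"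
  shows "\<exists>\<E>. finite \<E> \<and> (\<forall>f\<in>\<E>. chart_segment f) \<and> \<Union>(seg_set ` \<E>) = (\<Union>i\<in>I. seg_set (e i)) \<and>
    (\<forall>f\<in>\<E>. \<forall>f'\<in>\<E>. f \<noteq> f' \<longrightarrow> seg_interior f \<inter> seg_set f' = {})"
proof -
  define c where "c i = fst (e i)" for i
  define h where "h i t = (1 - t) *\<^sub>R fst (snd (e i)) + t *\<^sub>R snd (snd (e i))" for i t
  define g where "g i t = chart_inv (c i) (h i t)" for i t
  have ne: "fst (snd (e i)) \<noteq> snd (snd (e i))" if "i \<in> I" for i
    using seg[OF that] by (auto simp: chart_segment_def split: prod.splits)
  have cA: "c i \<in> \<A>" if "i \<in> I" for i
    using seg[OF that] by (auto simp: chart_segment_def c_def split: prod.splits)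
  have seg_h: "closed_segment (fst (snd (e i))) (snd (snd (e i))) = h i ` {0..1}" for i
    by (simp add: h_def[abs_def] closed_segment_image_interval)
  have himg: "h i ` {0..1} \<subseteq> chart_image (c i)" if "i \<in> I" for i
    using seg[OF that] unfolding seg_h[symmetric] by (auto simp: chart_segment_def c_def split: prod.splits)
  have Sg: "seg_set (e i) = g i ` {0..1}" for i
    by (simp add: seg_set_def case_prod_unfold seg_h g_def[abs_def] c_def image_image)
  have sub: "closed_segment (h i t) (h i t') = h i ` {t..t'}" "open_segment (h i t) (h i t') = h i ` {t<..<t'}"
    "h i t \<noteq> h i t'" if "i \<in> I" "t < t'" for i t t'
    using segment_subinterval[OF ne[OF that(1)] that(2)] unfolding h_def by blast+
  have ginj: "inj_on (g i) {0..1}" if "i \<in> I" for i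
  proof (rule inj_onI)
    fix s t :: real assume st: "s \<in> {0..1}" "t \<in> {0..1}" "g i s = g i t"
    then have "h i s = h i t"
      using inj_on_chart_inv himg[OF that] unfolding g_def by (metis image_subset_iff inj_onD)
    then show "s = t" using sub(3)[OF that, of s t] sub(3)[OF that, of t s] by (metis linorder_neqE)
  qed
  define P where "P = (\<Union>i\<in>I. \<Union>k\<in>I - {i}. seg_set (e i) \<inter> seg_set (e k)) \<union> (\<Union>i\<in>I. {g i 0, g i 1})"
  have finP: "finite P"
    unfolding P_def by (intro finite_UnI finite_UN_I) (use assms(1) fin in auto)
  define T where "T i = {t \<in> {0..1}. g i t \<in> P}" for i
  have T: "finite (T i)" "0 \<in> T i" "1 \<in> T i" "T i \<subseteq> {0..1}" if "i \<in> I" for i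
  proof -
    have "inj_on (g i) (T i)" using ginj[OF that] by (rule inj_on_subset) (auto simp: T_def)
    moreover have "finite (g i ` T i)" by (rule finite_subset[OF _ finP]) (auto simp: T_def)
    ultimately show "finite (T i)" using finite_imageD by blast
    show "0 \<in> T i" "1 \<in> T i" "T i \<subseteq> {0..1}" using that by (auto simp: T_def P_def)
  qed
  define J where "J = {(i, t, t'). i \<in> I \<and> t \<in> T i \<and> t' \<in> T i \<and> t < t' \<and> T i \<inter> {t<..<t'} = {}}"
  define f where "f = (\<lambda>(i, t, t'). (c i, h i t, h i t'))"
  have ftriple: "chart_segment (f (i,t,t'))" "seg_set (f (i,t,t')) = g i ` {t..t'}"
    "seg_interior (f (i,t,t')) = g i ` {t<..<t'}" "{t..t'} \<subseteq> {0..1}" if J: "(i,t,t') \<in> J" for i t t'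
  proof -
    have i: "i \<in> I" "t < t'" using J by (auto simp: J_def)
    show 01: "{t..t'} \<subseteq> {0..1}" using J T(4)[OF i(1)] by (auto simp: J_def)
    have "h i ` {t..t'} \<subseteq> chart_image (c i)" by (rule subset_trans[OF image_mono[OF 01] himg[OF i(1)]])
    then show "chart_segment (f (i,t,t'))" using sub[OF i] cA[OF i(1)] by (simp add: f_def chart_segment_def)
    show "seg_set (f (i,t,t')) = g i ` {t..t'}"
      by (simp add: f_def seg_set_def sub(1)[OF i] image_image g_def[abs_def])
    show "seg_interior (f (i,t,t')) = g i ` {t<..<t'}"
      by (simp add: f_def seg_interior_def sub(2)[OF i] image_image g_def[abs_def])
  qed
  have "J \<subseteq> Sigma I (\<lambda>i. T i \<times> T i)" by (auto simp: J_def)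
  then have finJ: "finite J" by (rule finite_subset) (use assms(1) T(1) in auto)
  have meet: "g i ` {t<..<t'} \<inter> g k ` {r..r'} = {}"
    if J: "(i,t,t') \<in> J" "(k,r,r') \<in> J" "(i,t,t') \<noteq> (k,r,r')" for i t t' k r r'
  proof (rule ccontr)
    assume "\<not> ?thesis"
    then obtain x s where x: "x \<in> {t<..<t'}" "s \<in> {r..r'}" "g i x = g k s" by force
    have i: "i \<in> I" and k: "k \<in> I" using J by (auto simp: J_def)
    have x01: "x \<in> {0..1}" "s \<in> {0..1}" using ftriple(4)[OF J(1)] ftriple(4)[OF J(2)] x by auto
    have "x \<notin> T i" using J(1) x(1) by (auto simp: J_def)
    then have notP: "g i x \<notin> P" using x01 by (simp add: T_def)
    have "i = k"
    proof (rule ccontr)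
      assume "i \<noteq> k"
      moreover have "g i x \<in> seg_set (e i)" "g i x \<in> seg_set (e k)" unfolding Sg using imageI[OF x01(1), of "g i"] imageI[OF x01(2), of "g k"] x(3) by simp_all
      ultimately have "g i x \<in> P" using i k unfolding P_def by auto
      then show False using notP by blast
    qed
    then have "x = s" using ginj[OF i] x01 x(3) by (auto dest: inj_onD)
    have "r \<notin> {t<..<t'}" "r' \<notin> {t<..<t'}" "t \<notin> {r<..<r'}" "t' \<notin> {r<..<r'}"
      using J(1,2) \<open>i = k\<close> by (auto simp: J_def)
    then have "r = t" "r' = t'" using x(1,2) \<open>x = s\<close> by auto
    then show False using J(3) \<open>i = k\<close> by simp
  qed
  show ?thesis
  proof (intro exI[of _ "f ` J"] conjI ballI impI)
    show "finite (f ` J)" using finJ by simp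
    show "chart_segment w" if "w \<in> f ` J" for w using that ftriple(1) by force
    show "\<Union>(seg_set ` f ` J) = (\<Union>i\<in>I. seg_set (e i))"
    proof (intro equalityI subsetI)
      fix x assume "x \<in> \<Union>(seg_set ` f ` J)"
      then obtain i t t' where J: "(i,t,t') \<in> J" "x \<in> seg_set (f (i,t,t'))" by force
      then have "x \<in> g i ` {0..1}" using ftriple(2,4)[OF J(1)] by auto
      then show "x \<in> (\<Union>i\<in>I. seg_set (e i))" unfolding Sg using J(1) by (auto simp: J_def)
    next
      fix x assume "x \<in> (\<Union>i\<in>I. seg_set (e i))"
      then obtain i s where i: "i \<in> I" "s \<in> {0..1}" "x = g i s" unfolding Sg by blast
      obtain t t' where t: "t \<in> T i" "t' \<in> T i" "t < t'" "T i \<inter> {t<..<t'} = {}" "s \<in> {t..t'}"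
        using consecutive_in_finite_set[OF T(1-3)[OF i(1)] i(2)] by blast
      then have J: "(i,t,t') \<in> J" using i by (simp add: J_def)
      then have "x \<in> seg_set (f (i,t,t'))" using ftriple(2)[OF J] t(5) i(3) by blast
      then show "x \<in> \<Union>(seg_set ` f ` J)" using J by blast
    qed
    show "seg_interior w \<inter> seg_set w' = {}" if w: "w \<in> f ` J" "w' \<in> f ` J" "w \<noteq> w'" for w w'
    proof -
      obtain i t t' where 1: "(i,t,t') \<in> J" "w = f (i,t,t')" using w(1) by force
      obtain k r r' where 2: "(k,r,r') \<in> J" "w' = f (k,r,r')" using w(2) by force
      have "(i,t,t') \<noteq> (k,r,r')" using 1 2 w(3) by auto
      then show ?thesis using meet[OF 1(1) 2(1)] ftriple(2)[OF 2(1)] ftriple(3)[OF 1(1)] 1(2) 2(2) by simp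
    qed
  qed
qed

end

section \<open>A curve near a separating compact set\<close>

definition shift :: "real^2 \<Rightarrow> real \<Rightarrow> real^2" where
  "shift y d = (\<chi> i. y$i + d)"

lemma shift_nth [simp]: "shift y d $ i = y$i + d"
  by (simp add: shift_def)

lemma square_subset_ball:
  assumes "0 < r" shows "cbox (shift y (- r/4)) (shift y (r/4)) \<subseteq> ball y r"
proof
  fix z assume z: "z \<in> cbox (shift y (- r/4)) (shift y (r/4))"
  have "\<bar>(z - y)$i\<bar> \<le> r/4" for i
  proof -
    have "y$i + - r/4 \<le> z$i \<and> z$i \<le> y$i + r/4" using z by (simp add: mem_box_cart)
    then show ?thesis unfolding vector_minus_component by linarith
  qed
  then have "(\<Sum>i\<in>UNIV. \<bar>(z - y)$i\<bar>) \<le> (\<Sum>i\<in>(UNIV::2 set). r/4)" by (intro sum_mono)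
  then have "norm (z - y) \<le> r/2" using norm_le_l1_cart[of "z - y"] by simp
  then show "z \<in> ball y r" using assms by (simp add: dist_norm norm_minus_commute)
qed

context surface_atlas
begin

text \<open>Around each point \<open>x\<close> of a finite set \<open>F\<close> there are three squares, all taken in one chart: an inner open one
\<open>B x\<close> of half side \<open>\<delta> x\<close>, such that these cover \<open>L\<close>; an outer closed one of half side \<open>2 * \<delta> x\<close>, contained
in \<open>U\<close>; and between them a rectangle \<open>D x\<close> whose four sides lie on walls in general position. The walls
run across the whole outer square. The walls contain the boundary of the union of the
rectangles, so they separate whatever \<open>L\<close> separates, as far as points outside \<open>N\<close> are concerned.
The sets \<open>W\<close> and \<open>N\<close> also serve as neighbourhoods of \<open>L\<close>.\<close>

lemma separating_curve:
  assumes U: "openin X U" "connectedin X U" and L: "compactin X L" "L \<subseteq> U"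
  obtains W N where "openin X W" "compactin X N" "L \<subseteq> W" "W \<subseteq> N" "N \<subseteq> U"
    "\<And>p q. p \<in> U - N \<Longrightarrow> q \<in> U - N \<Longrightarrow> \<not> joined_in X (U - L) p q \<Longrightarrow>
      \<exists>C. simple_closed_curve_in X C \<and> C \<subseteq> N \<and>
        (\<forall>x\<in>U - C. joined_in X (U - C) x p \<or> joined_in X (U - C) x q)"
proof -
  have "\<exists>c \<delta>. c \<in> \<A> \<and> x \<in> fst c \<and> 0 < \<delta> \<and> cbox (shift (snd c x) (-2*\<delta>)) (shift (snd c x) (2*\<delta>)) \<subseteq> chart_image c
     \<and> chart_inv c ` cbox (shift (snd c x) (-2*\<delta>)) (shift (snd c x) (2*\<delta>)) \<subseteq> U" if "x \<in> L" for x
  proof -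
    have xU: "x \<in> U" using that L(2) by blast
    obtain c where c: "c \<in> \<A>" "x \<in> fst c" using exists_chart xU openin_subset[OF U(1)] by blast
    obtain r where r: "r > 0" "ball (snd c x) r \<subseteq> chart_image c" "chart_inv c ` ball (snd c x) r \<subseteq> U"
      using chart_ball[OF c(1) U(1) xU c(2)] by blast
    have "cbox (shift (snd c x) (-2*(r/8))) (shift (snd c x) (2*(r/8))) \<subseteq> ball (snd c x) r"
      using square_subset_ball[OF r(1)] by simp
    then show ?thesis using c r by (intro exI[of _ c] exI[of _ "r/8"]) (auto dest: subsetD image_mono)
  qed
  then obtain c \<delta> where chart: "c x \<in> \<A>" "x \<in> fst (c x)" and \<delta>: "0 < \<delta> x"
    and img: "cbox (shift (snd (c x) x) (-2*\<delta> x)) (shift (snd (c x) x) (2*\<delta> x)) \<subseteq> chart_image (c x)"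
    and inU: "chart_inv (c x) ` cbox (shift (snd (c x) x) (-2*\<delta> x)) (shift (snd (c x) x) (2*\<delta> x)) \<subseteq> U"
    if "x \<in> L" for x by metis
  define y where "y x = snd (c x) x" for x
  define Q where "Q x r = cbox (shift (y x) (- r * \<delta> x)) (shift (y x) (r * \<delta> x))" for x r
  have Q2: "Q x 2 \<subseteq> chart_image (c x)" "chart_inv (c x) ` Q x 2 \<subseteq> U" if "x \<in> L" for x
    using img inU that by (auto simp: Q_def y_def)
  define B where "B x = chart_inv (c x) ` box (shift (y x) (- \<delta> x)) (shift (y x) (\<delta> x))" for x
  have boxQ: "box (shift (y x) (- \<delta> x)) (shift (y x) (\<delta> x)) \<subseteq> Q x 2" if "x \<in> L" for x
    using \<delta>[OF that] by (auto simp: Q_def mem_box_cart) (smt (verit))+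
  have openB: "openin X (B x)" if "x \<in> L" for x
    unfolding B_def using open_chart_inv_image[OF chart(1)[OF that] open_box] boxQ[OF that] Q2(1)[OF that] by blast
  have xB: "x \<in> B x" if "x \<in> L" for x
  proof -
    have "y x \<in> box (shift (y x) (- \<delta> x)) (shift (y x) (\<delta> x))" using \<delta>[OF that] by (simp add: mem_box_cart)
    then show ?thesis unfolding B_def using chart_inv_chart[OF chart[OF that]] by (metis image_eqI y_def)
  qed
  obtain F where F: "finite F" "F \<subseteq> L" "L \<subseteq> (\<Union>x\<in>F. B x)"
  proof -
    have "\<exists>\<F>. finite \<F> \<and> \<F> \<subseteq> B ` L \<and> L \<subseteq> \<Union>\<F>"
      by (rule compactinD[OF L(1)]) (use openB xB in auto)
    then show ?thesis using that finite_subset_image by metis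
  qed
  \<comment> \<open>The index \<open>(x, j, b)\<close> stands for the wall near \<open>x\<close> orthogonal to axis \<open>j\<close>, on its upper side if \<open>b\<close> and on its lower side otherwise.\<close>
  define I where "I = F \<times> (UNIV :: 2 set) \<times> (UNIV :: bool set)"
  have finI: "finite I" using F(1) by (simp add: I_def)
  define ci where "ci i = c (fst i)" for i :: "'a \<times> 2 \<times> bool"
  define li where "li i = shift (y (fst i)) (- 2 * \<delta> (fst i))" for i :: "'a \<times> 2 \<times> bool"
  define ui where "ui i = shift (y (fst i)) (2 * \<delta> (fst i))" for i :: "'a \<times> 2 \<times> bool"
  define ji where "ji i = fst (snd i)" for i :: "'a \<times> 2 \<times> bool"
  define lo where "lo i = y (fst i) $ ji i + (if snd (snd i) then \<delta> (fst i) else - 2 * \<delta> (fst i))" for i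
  define hi where "hi i = lo i + \<delta> (fst i)" for i
  have fI: "fst i \<in> L" if "i \<in> I" for i using that F(2) by (auto simp: I_def)
  have cI: "ci i \<in> \<A> \<and> cbox (li i) (ui i) \<subseteq> chart_image (ci i)" if "i \<in> I" for i
    using chart(1)[OF fI[OF that]] Q2(1)[OF fI[OF that]] by (simp add: ci_def li_def ui_def Q_def)
  have luI: "li i $ k \<le> ui i $ k" if "i \<in> I" for i k
    using \<delta>[OF fI[OF that]] by (simp add: li_def ui_def)
  have lohi: "lo i < hi i \<and> li i $ ji i \<le> lo i \<and> hi i \<le> ui i $ ji i" if "i \<in> I" for i
    using \<delta>[OF fI[OF that]] by (simp add: li_def ui_def lo_def hi_def)
  have "\<exists>s. (\<forall>i\<in>I. lo i < s i \<and> s i < hi i) \<and> (\<forall>i\<in>I. \<forall>k\<in>I. i \<noteq> k \<longrightarrow>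
    finite (wall (ci i) (li i) (ui i) (ji i) (s i) \<inter> wall (ci k) (li k) (ui k) (ji k) (s k)))"
    by (rule generic_walls[OF finI]) (simp_all add: cI luI lohi)
  then obtain s where s: "\<And>i. i \<in> I \<Longrightarrow> lo i < s i \<and> s i < hi i"
    and fin: "\<And>i k. i \<in> I \<Longrightarrow> k \<in> I \<Longrightarrow> i \<noteq> k \<Longrightarrow>
       finite (wall (ci i) (li i) (ui i) (ji i) (s i) \<inter> wall (ci k) (li k) (ui k) (ji k) (s k))"
    by metis
  define w where "w i = wall (ci i) (li i) (ui i) (ji i) (s i)" for i
  define e where "e i = (ci i, (\<chi> k. if k = ji i then s i else li i $ k), (\<chi> k. if k = ji i then s i else ui i $ k) :: real^2)" for i
  have slice: "{z \<in> cbox (li i) (ui i). z $ ji i = s i} =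
      closed_segment (\<chi> k. if k = ji i then s i else li i $ k) (\<chi> k. if k = ji i then s i else ui i $ k)" if "i \<in> I" for i
    using box_slice_eq_segment[of "li i" "ji i" "s i" "ui i"] s[OF that] lohi[OF that] luI[OF that] by force
  have seg_w: "seg_set (e i) = w i" if "i \<in> I" for i
    using slice[OF that] by (simp add: e_def seg_set_def w_def wall_def)
  have chart_seg: "chart_segment (e i)" if i: "i \<in> I" for i
  proof -
    obtain k where "k \<noteq> ji i" by (metis one_neq_zero zero_neq_one)
    moreover have "li i $ k < ui i $ k" using \<delta>[OF fI[OF i]] by (simp add: li_def ui_def)
    ultimately have "(\<chi> k. if k = ji i then s i else li i $ k) \<noteq> (\<chi> k. if k = ji i then s i else ui i $ k)"
      by (auto simp: vec_eq_iff intro!: exI[of _ k])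
    moreover have "closed_segment (\<chi> k. if k = ji i then s i else li i $ k) (\<chi> k. if k = ji i then s i else ui i $ k)
        \<subseteq> chart_image (ci i)"
      using cI[OF i] unfolding slice[OF i, symmetric] by auto
    ultimately show ?thesis using cI[OF i] unfolding e_def chart_segment_def case_prod_conv by (intro conjI) simp_all
  qed
  have "\<exists>\<E>. finite \<E> \<and> (\<forall>f\<in>\<E>. chart_segment f) \<and> \<Union>(seg_set ` \<E>) = (\<Union>i\<in>I. seg_set (e i)) \<and>
    (\<forall>f\<in>\<E>. \<forall>f'\<in>\<E>. f \<noteq> f' \<longrightarrow> seg_interior f \<inter> seg_set f' = {})"
    using fin seg_w unfolding w_def by (intro subdivide_segments[OF finI]) (simp_all add: chart_seg)
  then obtain \<E> where \<E>: "finite \<E>" "\<And>f. f \<in> \<E> \<Longrightarrow> chart_segment f"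
    "\<Union>(seg_set ` \<E>) = (\<Union>i\<in>I. seg_set (e i))"
    "\<And>f f'. f \<in> \<E> \<Longrightarrow> f' \<in> \<E> \<Longrightarrow> f \<noteq> f' \<Longrightarrow> seg_interior f \<inter> seg_set f' = {}"
    by metis
  define N where "N = (\<Union>x\<in>F. chart_inv (c x) ` Q x 2)"
  have w_N: "w i \<subseteq> N" if "i \<in> I" for i
  proof -
    have "w i \<subseteq> chart_inv (c (fst i)) ` Q (fst i) 2" by (auto simp: w_def wall_def ci_def li_def ui_def Q_def)
    moreover have "fst i \<in> F" using that by (auto simp: I_def)
    ultimately show ?thesis unfolding N_def by blast
  qed
  define G where "G = (\<Union>i\<in>I. w i)"
  have GE: "\<Union>(seg_set ` \<E>) = G" unfolding \<E>(3) G_def using seg_w by simp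
  have GN: "G \<subseteq> N" unfolding G_def using w_N by blast
  have NU: "N \<subseteq> U" unfolding N_def using Q2(2) F(2) by blast
  have compN: "compactin X N" unfolding N_def
  proof (rule compactin_Union)
    show "finite ((\<lambda>x. chart_inv (c x) ` Q x 2) ` F)" using F(1) by simp
    fix S assume "S \<in> (\<lambda>x. chart_inv (c x) ` Q x 2) ` F"
    then obtain x where "x \<in> F" "S = chart_inv (c x) ` Q x 2" by blast
    then show "compactin X S"
      using compact_chart_inv_image[OF chart(1) _ Q2(1)] F(2) by (auto simp: Q_def)
  qed
  define lw where "lw x = (\<chi> j. s (x, j, False))" for x
  define uw where "uw x = (\<chi> j. s (x, j, True))" for x
  have bounds: "y x $ j - 2 * \<delta> x < lw x $ j" "lw x $ j < y x $ j - \<delta> x"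
    "y x $ j + \<delta> x < uw x $ j" "uw x $ j < y x $ j + 2 * \<delta> x" if "x \<in> F" for x j
    using s[of "(x, j, False)"] s[of "(x, j, True)"] that by (simp_all add: I_def lo_def hi_def ji_def lw_def uw_def)
  define D where "D x = chart_inv (c x) ` cbox (lw x) (uw x)" for x
  define D0 where "D0 x = chart_inv (c x) ` box (lw x) (uw x)" for x
  have cD: "cbox (lw x) (uw x) \<subseteq> Q x 2" if "x \<in> F" for x
  proof
    fix z assume "z \<in> cbox (lw x) (uw x)"
    then have "lw x $ j \<le> z $ j" "z $ j \<le> uw x $ j" for j by (auto simp: mem_box_cart)
    then have "y x $ j - 2 * \<delta> x \<le> z $ j" "z $ j \<le> y x $ j + 2 * \<delta> x" for j
      using bounds(1,4)[OF that, of j] by (meson less_eq_real_def order.trans)+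
    then show "z \<in> Q x 2" by (simp add: Q_def mem_box_cart)
  qed
  have B_D0: "B x \<subseteq> D0 x" if "x \<in> F" for x
  proof -
    have "box (shift (y x) (- \<delta> x)) (shift (y x) (\<delta> x)) \<subseteq> box (lw x) (uw x)"
    proof
      fix z assume "z \<in> box (shift (y x) (- \<delta> x)) (shift (y x) (\<delta> x))"
      then have "y x $ j - \<delta> x < z $ j" "z $ j < y x $ j + \<delta> x" for j by (auto simp: mem_box_cart)
      then have "lw x $ j < z $ j" "z $ j < uw x $ j" for j
        using bounds(2,3)[OF that, of j] by (meson order.strict_trans)+
      then show "z \<in> box (lw x) (uw x)" by (simp add: mem_box_cart)
    qed
    then show ?thesis unfolding B_def D0_def by (rule image_mono)
  qed
  have openD0: "openin X (D0 x)" if "x \<in> F" for x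
    unfolding D0_def using that F(2) cD[OF that] Q2(1)[of x] box_subset_cbox[of "lw x" "uw x"]
    by (intro open_chart_inv_image chart(1) open_box) auto
  have closedD: "closedin X (D x)" if "x \<in> F" for x
    unfolding D_def using that F(2) cD[OF that] Q2(1)[of x]
    by (intro compactin_imp_closedin[OF hausdorff] compact_chart_inv_image chart(1) compact_cbox) auto
  have D_wall: "D x - D0 x \<subseteq> G" if x: "x \<in> F" for x
  proof
    fix v assume v: "v \<in> D x - D0 x"
    then obtain z where z: "z \<in> cbox (lw x) (uw x)" "v = chart_inv (c x) z" by (auto simp: D_def)
    then have "z \<notin> box (lw x) (uw x)" using v by (auto simp: D0_def)
    then obtain j where "\<not> (lw x $ j < z $ j \<and> z $ j < uw x $ j)" by (auto simp: mem_box_cart)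
    moreover have "lw x $ j \<le> z $ j \<and> z $ j \<le> uw x $ j" using z(1) by (simp add: mem_box_cart)
    ultimately have "z $ j = lw x $ j \<or> z $ j = uw x $ j" by linarith
    then obtain b where b: "z $ j = s (x, j, b)" by (auto simp: lw_def uw_def)
    have "z \<in> Q x 2" using cD[OF x] z(1) by blast
    then have "v \<in> w (x, j, b)" using z(2) b
      by (auto simp: w_def wall_def ci_def li_def ui_def ji_def Q_def)
    then show "v \<in> G" using x by (auto simp: G_def I_def)
  qed
  have DN: "D x \<subseteq> N" if "x \<in> F" for x
    using image_mono[OF cD[OF that], of "chart_inv (c x)"] that unfolding D_def N_def by blast
  show ?thesis
  proof (rule that)
    show "openin X (\<Union>x\<in>F. D0 x)" using openD0 by blast
    show "compactin X N" by (rule compN)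
    show "L \<subseteq> (\<Union>x\<in>F. D0 x)" using F(3) B_D0 by blast
    have "D0 x \<subseteq> D x" for x unfolding D_def D0_def by (rule image_mono[OF box_subset_cbox])
    then show "(\<Union>x\<in>F. D0 x) \<subseteq> N" using DN by blast
    show "N \<subseteq> U" by (rule NU)
    fix p q assume p: "p \<in> U - N" and q: "q \<in> U - N" and nj: "\<not> joined_in X (U - L) p q"
    have "\<not> joined_in X (U - \<Union>(seg_set ` \<E>)) p q"
    proof
      assume "joined_in X (U - \<Union>(seg_set ` \<E>)) p q"
      then obtain T where T: "connectedin X T" "T \<subseteq> U - G" "p \<in> T" "q \<in> T"
        unfolding GE joined_in_iff by blast
      have clD: "closedin X (\<Union>x\<in>F. D x)" using F(1) closedD by (intro closedin_Union) auto
      have "T \<inter> (\<Union>x\<in>F. D0 x) = {}"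
      proof (rule connectedin_open_split[OF T(1)])
        show "openin X (topspace X - (\<Union>x\<in>F. D x))" using clD by blast
        show "openin X (\<Union>x\<in>F. D0 x)" using openD0 by blast
        show "T \<subseteq> topspace X - (\<Union>x\<in>F. D x) \<union> (\<Union>x\<in>F. D0 x)"
        proof
          fix v assume v: "v \<in> T"
          then have "v \<in> topspace X" "v \<notin> G" using T(2) connectedin_subset_topspace[OF T(1)] by auto
          then show "v \<in> topspace X - (\<Union>x\<in>F. D x) \<union> (\<Union>x\<in>F. D0 x)" using D_wall by blast
        qed
        show "(topspace X - (\<Union>x\<in>F. D x)) \<inter> (\<Union>x\<in>F. D0 x) \<inter> T = {}" using \<open>\<And>x. D0 x \<subseteq> D x\<close> by blast
        have "p \<notin> (\<Union>x\<in>F. D x)" using p DN by blast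
        then show "T \<inter> (topspace X - (\<Union>x\<in>F. D x)) \<noteq> {}"
          using T(3) connectedin_subset_topspace[OF T(1)] by auto
      qed
      then have "T \<subseteq> U - L" using T(2) \<open>L \<subseteq> (\<Union>x\<in>F. D0 x)\<close> by blast
      then show False using nj T by (auto simp: joined_in_iff)
    qed
    moreover have "seg_set f \<subseteq> U" if "f \<in> \<E>" for f
    proof -
      have "seg_set f \<subseteq> \<Union>(seg_set ` \<E>)" using that by blast
      then show ?thesis using GE GN NU by simp
    qed
    moreover have "p \<notin> \<Union>(seg_set ` \<E>)" "q \<notin> \<Union>(seg_set ` \<E>)" using p q GE GN by auto
    ultimately obtain C where C: "simple_closed_curve_in X C" "C \<subseteq> \<Union>(seg_set ` \<E>)"
      "\<And>x. x \<in> U - C \<Longrightarrow> joined_in X (U - C) x p \<or> joined_in X (U - C) x q"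
      using finite_graph_cut_curve[OF U \<E>(1,2) _ \<E>(4), of p q] p q by blast
    then show "\<exists>C. simple_closed_curve_in X C \<and> C \<subseteq> N \<and>
        (\<forall>x\<in>U - C. joined_in X (U - C) x p \<or> joined_in X (U - C) x q)"
    proof (intro exI[of _ C] conjI ballI)
      show "C \<subseteq> N" using C(2) GE GN by simp
    qed (use C in auto)
  qed
qed

end

section \<open>Many curves from many ends\<close>

text \<open>This is the part of the notion of an ideal boundary component that survives cutting \<open>U\<close> along
a curve: for a component \<open>W\<close> of the rest, the frontiers of the sets \<open>P n\<close> need not stay away from
the curve, but any compact subset of \<open>W\<close> is still left eventually.\<close>

definition escapes :: "'a topology \<Rightarrow> 'a set \<Rightarrow> (nat \<Rightarrow> 'a set) \<Rightarrow> bool" where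
  "escapes X U P \<longleftrightarrow> decseq P \<and> (\<forall>n. connectedin X (P n) \<and> P n \<noteq> {}) \<and> (\<exists>n. P n \<subseteq> U) \<and>
     (\<forall>L. compactin X L \<and> L \<subseteq> U \<longrightarrow> (\<exists>n. P n \<inter> L = {}))"

definition separated_in :: "'a topology \<Rightarrow> 'a set \<Rightarrow> (nat \<Rightarrow> 'a set) \<Rightarrow> (nat \<Rightarrow> 'a set) \<Rightarrow> bool" where
  "separated_in X U P Q \<longleftrightarrow> (\<exists>L n. compactin X L \<and> L \<subseteq> U \<and> (\<forall>p\<in>P n. \<forall>q\<in>Q n. \<not> joined_in X (U - L) p q))"

lemma separated_in_sym: "separated_in X U P Q \<Longrightarrow> separated_in X U Q P"
  unfolding separated_in_def by (metis connected_component_of_sym)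

lemma escapes_subset: "escapes X U P \<Longrightarrow> W \<subseteq> U \<Longrightarrow> P n \<subseteq> W \<Longrightarrow> escapes X W P"
  unfolding escapes_def by (meson order_trans)

lemma joined_in_absorb:
  assumes "connectedin X T" "T \<subseteq> S" "x \<in> T"
  shows "T \<subseteq> component_in X S x"
  using assms by (auto simp: joined_in_iff)

lemma escapes_avoid:
  assumes "escapes X U P" "compactin X L" "L \<subseteq> U"
  shows "\<exists>n0. \<forall>n\<ge>n0. P n \<subseteq> U \<and> P n \<inter> L = {}"
proof -
  obtain m where m: "P m \<subseteq> U" using assms(1) by (auto simp: escapes_def)
  obtain k where k: "P k \<inter> L = {}" using assms by (auto simp: escapes_def)
  have "P n \<subseteq> P m \<and> P n \<subseteq> P k" if "n \<ge> max m k" for n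
    using assms(1) that by (simp add: escapes_def decseqD)
  then show ?thesis using m k by (intro exI[of _ "max m k"]) blast
qed

context surface_atlas
begin

text \<open>The set \<open>L\<close> itself need not be compact inside \<open>W\<close>, since it may touch \<open>C\<close>. Instead take a
compact neighbourhood \<open>N\<close> of \<open>L \<union> C\<close>, containing an open neighbourhood \<open>V\<close>. The
part of \<open>N - V\<close> inside \<open>W\<close> is compact, and a connected set that avoids it and starts outside \<open>N\<close> never
enters \<open>V\<close>, hence never meets \<open>L\<close>.\<close>

lemma separated_in_component:
  fixes x :: 'a
  assumes U: "openin X U" "connectedin X U" and C: "compactin X C" "C \<subseteq> U"
    and P: "escapes X U P" and Q: "escapes X U Q" and sep: "separated_in X U P Q"
  defines "W \<equiv> component_in X (U - C) x"
  shows "separated_in X W P Q"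
proof -
  obtain L n0 where L: "compactin X L" "L \<subseteq> U" "\<forall>p\<in>P n0. \<forall>q\<in>Q n0. \<not> joined_in X (U - L) p q"
    using sep by (auto simp: separated_in_def)
  have LC: "compactin X (L \<union> C)" "L \<union> C \<subseteq> U" using L C by (auto simp: compactin_Un)
  obtain V N where V: "openin X V" "compactin X N" "L \<union> C \<subseteq> V" "V \<subseteq> N" "N \<subseteq> U"
    using separating_curve[OF U LC] .
  have closN: "closedin X N" using compactin_imp_closedin[OF hausdorff V(2)] .
  have openUC: "openin X (U - C)" using U(1) compactin_imp_closedin[OF hausdorff C(1)] by blast
  \<comment> \<open>The union of the other components of \<open>U - C\<close> is open, so \<open>W\<close> is relatively closed in \<open>U - C\<close>.\<close>
  define R where "R = \<Union>(component_in X (U - C) ` (U - C - W))"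
  have openR: "openin X R" unfolding R_def using openin_component_in[OF openUC] by blast
  have RW: "R = U - C - W"
  proof
    show "U - C - W \<subseteq> R"
    proof
      fix y assume y: "y \<in> U - C - W"
      then have "y \<in> component_in X (U - C) y" using joined_in_refl[OF _ openin_subset[OF openUC], of y] by simp
      then show "y \<in> R" using y unfolding R_def by blast
    qed
    show "R \<subseteq> U - C - W"
    proof
      fix z assume "z \<in> R"
      then obtain y where y: "y \<in> U - C" "y \<notin> W" "joined_in X (U - C) y z" unfolding R_def by blast
      have "z \<in> U - C" using y(3) component_in_subset[of X "U - C" y] by blast
      moreover have "z \<notin> W" using y unfolding W_def
        by (metis connected_component_of_sym connected_component_of_trans mem_Collect_eq)
      ultimately show "z \<in> U - C - W" by blast
    qed
  qed
  define F where "F = N - V - R"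
  have "compactin X F"
  proof (rule closed_compactin[OF V(2)])
    show "F \<subseteq> N" unfolding F_def by blast
    show "closedin X F" unfolding F_def by (intro closedin_diff closN V(1) openR)
  qed
  moreover have "F \<subseteq> W" unfolding F_def RW using V(3,5) by blast
  moreover obtain n where n: "n \<ge> n0" "P n \<inter> N = {}" "Q n \<inter> N = {}"
  proof -
    obtain a b where "\<forall>n\<ge>a. P n \<inter> N = {}" "\<forall>n\<ge>b. Q n \<inter> N = {}"
      using escapes_avoid[OF P V(2,5)] escapes_avoid[OF Q V(2,5)] by blast
    then show ?thesis using that[of "max n0 (max a b)"] by simp
  qed
  moreover have "\<not> joined_in X (W - F) p q" if pq: "p \<in> P n" "q \<in> Q n" for p q
  proof
    assume "joined_in X (W - F) p q"
    then obtain T where T: "connectedin X T" "T \<subseteq> W - F" "p \<in> T" "q \<in> T" by (auto simp: joined_in_iff)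
    have WU: "W \<subseteq> U - C" unfolding W_def by (rule component_in_subset)
    have "T \<inter> V = {}"
    proof (rule connectedin_open_split[OF T(1) _ V(1)])
      show "openin X (topspace X - N)" using closN by blast
      show "T \<subseteq> topspace X - N \<union> V"
        using T(2) WU openin_subset[OF U(1)] unfolding F_def RW by blast
      show "(topspace X - N) \<inter> V \<inter> T = {}" using V(4) by blast
      show "T \<inter> (topspace X - N) \<noteq> {}"
        using T(3) n(2) pq(1) connectedin_subset_topspace[OF T(1)] by blast
    qed
    then have "T \<subseteq> U - L" using T(2) WU V(3) by blast
    then have "joined_in X (U - L) p q" using T by (auto simp: joined_in_iff)
    moreover have "P n \<subseteq> P n0" "Q n \<subseteq> Q n0" using P Q n(1) by (auto simp: escapes_def dest: decseqD)
    ultimately show False using L(3) pq by blast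
  qed
  ultimately show ?thesis unfolding separated_in_def by blast
qed

lemma simple_closed_curve_nonempty: "simple_closed_curve_in X C \<Longrightarrow> C \<noteq> {}"
  by (auto simp: simple_closed_curve_in_def)

lemma component_in_mono: "S \<subseteq> T \<Longrightarrow> component_in X S x \<subseteq> component_in X T x"
  by (auto intro: connected_component_of_mono)

text \<open>Induction on the number of ends. If the curve \<open>C\<close> does not disconnect \<open>U\<close>, all ends but one are
kept, and \<open>C\<close> makes up for the lost one. Otherwise both pieces contain at least
one of the ends, and with \<open>a\<close> and \<open>b\<close> ends in the two pieces we get
\<open>(a - 1) + (b - 1) + 1 = (a + b) - 1\<close> curves.\<close>

lemma nonseparating_curve_family:
  assumes "finite E" "E \<noteq> {}" "openin X U" "connectedin X U"
    "\<And>P. P \<in> E \<Longrightarrow> escapes X U P"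
    "\<And>P Q. P \<in> E \<Longrightarrow> Q \<in> E \<Longrightarrow> P \<noteq> Q \<Longrightarrow> separated_in X U P Q"
  shows "\<exists>\<C>. finite \<C> \<and> (\<forall>C\<in>\<C>. simple_closed_curve_in X C \<and> C \<subseteq> U) \<and> pairwise disjnt \<C> \<and>
     card E \<le> card \<C> + 1 \<and> (\<forall>x\<in>U - \<Union>\<C>. \<exists>P\<in>E. \<exists>n. P n \<subseteq> component_in X (U - \<Union>\<C>) x)"
  using assms
proof (induction "card E" arbitrary: E U rule: less_induct)
  case less
  note fin = less.prems(1) and ne = less.prems(2) and U = less.prems(3,4)
    and esc = less.prems(5) and sep = less.prems(6)
  obtain P where P: "P \<in> E" using ne by blast
  show ?case
  proof (cases "E = {P}")
    case True
    obtain n where "P n \<subseteq> U" using esc[OF P] by (auto simp: escapes_def)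
    then have "\<exists>n. P n \<subseteq> component_in X U x" if "x \<in> U" for x
      using joined_in_absorb[OF U(2) order_refl that] by blast
    then show ?thesis using True by (intro exI[of _ "{}"]) auto
  next
    case False
    then obtain Q where Q: "Q \<in> E" "P \<noteq> Q" using P by blast
    obtain L n0 where L: "compactin X L" "L \<subseteq> U" "\<forall>p\<in>P n0. \<forall>q\<in>Q n0. \<not> joined_in X (U - L) p q"
      using sep[OF P Q] by (auto simp: separated_in_def)
    obtain V N where N: "compactin X N" "N \<subseteq> U" and cut: "\<And>p q. p \<in> U - N \<Longrightarrow> q \<in> U - N \<Longrightarrow> \<not> joined_in X (U - L) p q \<Longrightarrow>
        \<exists>C. simple_closed_curve_in X C \<and> C \<subseteq> N \<and>
        (\<forall>x\<in>U - C. joined_in X (U - C) x p \<or> joined_in X (U - C) x q)"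
      using separating_curve[OF U L(1,2)] by metis
    obtain n where n: "n \<ge> n0" "P n \<subseteq> U - N" "Q n \<subseteq> U - N"
    proof -
      obtain a b where "\<forall>n\<ge>a. P n \<subseteq> U \<and> P n \<inter> N = {}" "\<forall>n\<ge>b. Q n \<subseteq> U \<and> Q n \<inter> N = {}"
        using escapes_avoid[OF esc[OF P] N] escapes_avoid[OF esc[OF Q(1)] N] by blast
      then show ?thesis using that[of "max n0 (max a b)"] by (simp add: Diff_eq disjoint_eq_subset_Compl)
    qed
    have conn: "connectedin X (R k)" "R k \<noteq> {}" if "R \<in> E" for R k
      using esc[OF that] by (simp_all add: escapes_def)
    have dec: "R k \<subseteq> R l" if "R \<in> E" "l \<le> k" for R k l
      using esc[OF that(1)] that(2) by (simp add: escapes_def decseqD)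
    obtain p q where pq: "p \<in> P n" "q \<in> Q n" using conn(2)[OF P, of n] conn(2)[OF Q(1), of n] by auto
    have "P n \<subseteq> P n0" "Q n \<subseteq> Q n0" using dec[OF P n(1)] dec[OF Q(1) n(1)] .
    then have "\<not> joined_in X (U - L) p q" using L(3) pq by blast
    then obtain C where C: "simple_closed_curve_in X C" "C \<subseteq> N"
      "\<forall>x\<in>U - C. joined_in X (U - C) x p \<or> joined_in X (U - C) x q"
      using cut[of p q] pq n by blast
    have CU: "C \<subseteq> U" using C(2) N(2) by blast
    have Cc: "compactin X C" by (rule compactin_simple_closed_curve[OF C(1)])
    have Cne: "C \<noteq> {}" by (rule simple_closed_curve_nonempty[OF C(1)])
    have openUC: "openin X (U - C)" using U(1) compactin_imp_closedin[OF hausdorff Cc] by blast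
    define W where "W y = component_in X (U - C) y" for y
    have openW: "openin X (W y)" for y unfolding W_def by (rule openin_component_in[OF openUC])
    have connW: "connectedin X (W y)" for y unfolding W_def by (rule connectedin_component_in)
    have subW: "W y \<subseteq> U - C" for y unfolding W_def by (rule component_in_subset)
    have "P n \<subseteq> U - C" "Q n \<subseteq> U - C" using n(2,3) C(2) by blast+
    then have PW: "P n \<subseteq> W p" "Q n \<subseteq> W q"
      unfolding W_def using joined_in_absorb[OF conn(1)[OF P] _ pq(1)] joined_in_absorb[OF conn(1)[OF Q(1)] _ pq(2)]
      by simp_all
    have UCW: "U - C \<subseteq> W p \<union> W q"
      using C(3) unfolding W_def by (auto simp: connected_component_of_sym[of _ p] connected_component_of_sym[of _ q])
    define good where "good y F \<C> \<longleftrightarrow> finite \<C> \<and> (\<forall>D\<in>\<C>. simple_closed_curve_in X D \<and> D \<subseteq> W y) \<and> pairwise disjnt \<C> \<and>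
     card F \<le> card \<C> + 1 \<and> (\<forall>x\<in>W y - \<Union>\<C>. \<exists>P\<in>F. \<exists>n. P n \<subseteq> component_in X (W y - \<Union>\<C>) x)" for y \<C> and F :: "(nat \<Rightarrow> 'a set) set"
    have IH: "\<exists>\<C>. good y F \<C>"
      if F: "F \<subseteq> E" "F \<noteq> {}" "F \<noteq> E" "\<And>R. R \<in> F \<Longrightarrow> \<exists>n. R n \<subseteq> W y" for F y
      unfolding good_def
    proof (rule less.hyps)
      show "card F < card E" using F fin by (simp add: psubset_card_mono psubsetI)
      show "finite F" using F(1) fin by (rule finite_subset)
      show "escapes X (W y) R" if "R \<in> F" for R
        using escapes_subset[OF esc] F that subW[of y] by (meson Diff_subset order_trans subsetD)
      show "separated_in X (W y) R S" if "R \<in> F" "S \<in> F" "R \<noteq> S" for R S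
        unfolding W_def using that F(1) by (intro separated_in_component[OF U Cc CU] esc sep) auto
    qed (use F openW connW in auto)
    have ends: "\<exists>n. R n \<subseteq> W p \<or> R n \<subseteq> W q" if RE: "R \<in> E" for R
    proof -
      obtain k where k: "R k \<subseteq> U - C" using escapes_avoid[OF esc[OF RE] Cc CU] by blast
      have R: "connectedin X (R k)" "R k \<noteq> {}" by (rule conn[OF RE])+
      then have "R k \<inter> W p \<noteq> {} \<or> R k \<inter> W q \<noteq> {}" using k UCW by blast
      then show ?thesis unfolding W_def using component_in_absorb[OF R(1) k] by blast
    qed
    show ?thesis
    proof (cases "joined_in X (U - C) p q")
      case True
      then have "W q = W p" unfolding W_def by (metis connected_component_of_equiv)
      then have UC: "W p = U - C" using UCW subW[of p] by blast
      have "\<exists>n. R n \<subseteq> W p" if "R \<in> E - {P}" for R using ends[of R] that \<open>W q = W p\<close> by auto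
      then obtain \<C> where "good p (E - {P}) \<C>" using IH[of "E - {P}" p] P Q by auto
      then have \<C>: "finite \<C>" "\<forall>D\<in>\<C>. simple_closed_curve_in X D \<and> D \<subseteq> W p" "pairwise disjnt \<C>"
        "card (E - {P}) \<le> card \<C> + 1" "\<forall>x\<in>W p - \<Union>\<C>. \<exists>R\<in>E - {P}. \<exists>n. R n \<subseteq> component_in X (W p - \<Union>\<C>) x"
        by (simp_all add: good_def)
      have "C \<notin> \<C>" using \<C>(2) subW[of p] Cne by blast
      have eq: "U - \<Union>(insert C \<C>) = W p - \<Union>\<C>" using UC by auto
      have CD: "disjnt C D" if "D \<in> \<C>" for D using that \<C>(2) subW[of p] unfolding disjnt_def by blast
      show ?thesis
      proof (intro exI[of _ "insert C \<C>"] conjI)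
        show "finite (insert C \<C>)" using \<C>(1) by simp
        show "\<forall>D\<in>insert C \<C>. simple_closed_curve_in X D \<and> D \<subseteq> U" using \<C>(2) C(1) CU subW[of p] by blast
        show "pairwise disjnt (insert C \<C>)" using \<C>(3) CD by (auto simp: pairwise_insert disjnt_sym)
        show "card E \<le> card (insert C \<C>) + 1" using \<C>(1,4) \<open>C \<notin> \<C>\<close> P fin by simp
        show "\<forall>x\<in>U - \<Union>(insert C \<C>). \<exists>R\<in>E. \<exists>n. R n \<subseteq> component_in X (U - \<Union>(insert C \<C>)) x"
          unfolding eq using \<C>(5) by blast
      qed
    next
      case False
      have disj: "W p \<inter> W q = {}"
        unfolding W_def using False connected_component_of_disjoint unfolding disjnt_def by metis
      define Ep where "Ep = {R \<in> E. \<exists>n. R n \<subseteq> W p}"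
      have "P \<in> Ep" using P PW(1) by (auto simp: Ep_def)
      have "Q \<notin> Ep"
      proof
        assume "Q \<in> Ep"
        then obtain k where "Q k \<subseteq> W p" by (auto simp: Ep_def)
        moreover have "Q (max k n) \<subseteq> Q k" "Q (max k n) \<subseteq> Q n" "Q (max k n) \<noteq> {}"
          using dec[OF Q(1)] conn(2)[OF Q(1)] by simp_all
        ultimately show False using PW(2) disj by blast
      qed
      have "Ep \<subseteq> E" by (auto simp: Ep_def)
      moreover have "Ep \<noteq> E" "Ep \<noteq> {}" using \<open>P \<in> Ep\<close> \<open>Q \<notin> Ep\<close> Q(1) by auto
      moreover have "\<exists>n. R n \<subseteq> W p" if "R \<in> Ep" for R using that by (simp add: Ep_def)
      ultimately obtain \<C>p where "good p Ep \<C>p" using IH[of Ep p] by metis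
      then have \<C>p: "finite \<C>p" "\<forall>D\<in>\<C>p. simple_closed_curve_in X D \<and> D \<subseteq> W p" "pairwise disjnt \<C>p"
        "card Ep \<le> card \<C>p + 1" "\<forall>x\<in>W p - \<Union>\<C>p. \<exists>R\<in>Ep. \<exists>n. R n \<subseteq> component_in X (W p - \<Union>\<C>p) x"
        by (simp_all add: good_def)
      have "\<exists>n. R n \<subseteq> W q" if "R \<in> E - Ep" for R using ends[of R] that by (auto simp: Ep_def)
      moreover have "E - Ep \<noteq> {}" "E - Ep \<noteq> E" using \<open>P \<in> Ep\<close> \<open>Q \<notin> Ep\<close> Q(1) P by auto
      ultimately obtain \<C>q where "good q (E - Ep) \<C>q" using IH[of "E - Ep" q, OF Diff_subset] by metis
      then have \<C>q: "finite \<C>q" "\<forall>D\<in>\<C>q. simple_closed_curve_in X D \<and> D \<subseteq> W q" "pairwise disjnt \<C>q"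
        "card (E - Ep) \<le> card \<C>q + 1" "\<forall>x\<in>W q - \<Union>\<C>q. \<exists>R\<in>E - Ep. \<exists>n. R n \<subseteq> component_in X (W q - \<Union>\<C>q) x"
        by (simp_all add: good_def)
      define \<C> where "\<C> = insert C (\<C>p \<union> \<C>q)"
      have "C \<notin> \<C>p \<union> \<C>q" using \<C>p(2) \<C>q(2) subW[of p] subW[of q] Cne by blast
      have "\<C>p \<inter> \<C>q = {}"
      proof (rule ccontr)
        assume "\<C>p \<inter> \<C>q \<noteq> {}"
        then obtain D where "D \<in> \<C>p" "D \<in> \<C>q" by blast
        then have "simple_closed_curve_in X D" "D \<subseteq> W p" "D \<subseteq> W q" using \<C>p(2) \<C>q(2) by blast+
        then show False using disj simple_closed_curve_nonempty by blast
      qed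
      have CD: "disjnt C D" if "D \<in> \<C>p \<union> \<C>q" for D
        using that \<C>p(2) \<C>q(2) subW[of p] subW[of q] unfolding disjnt_def by blast
      have DD: "disjnt D D'" if "D \<in> \<C>p" "D' \<in> \<C>q" for D D'
        using that \<C>p(2) \<C>q(2) disj unfolding disjnt_def by blast
      show ?thesis
      proof (intro exI[of _ \<C>] conjI)
        show "finite \<C>" using \<C>p(1) \<C>q(1) by (simp add: \<C>_def)
        show "\<forall>D\<in>\<C>. simple_closed_curve_in X D \<and> D \<subseteq> U"
          using \<C>p(2) \<C>q(2) C(1) CU subW[of p] subW[of q] unfolding \<C>_def by blast
        have "pairwise disjnt (\<C>p \<union> \<C>q)"
          using \<C>p(3) \<C>q(3) DD unfolding pairwise_def by (metis UnE disjnt_sym)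
        then show "pairwise disjnt \<C>" using CD by (auto simp: \<C>_def pairwise_insert disjnt_sym)
        have "card E = card Ep + card (E - Ep)"
          using fin by (subst card_Un_disjoint[symmetric]) (auto simp: Ep_def intro: arg_cong[of _ _ card])
        moreover have "card \<C> = card \<C>p + card \<C>q + 1"
          using \<C>p(1) \<C>q(1) \<open>C \<notin> \<C>p \<union> \<C>q\<close> \<open>\<C>p \<inter> \<C>q = {}\<close> by (simp add: \<C>_def card_Un_disjoint)
        ultimately show "card E \<le> card \<C> + 1" using \<C>p(4) \<C>q(4) by simp
        show "\<forall>x\<in>U - \<Union>\<C>. \<exists>R\<in>E. \<exists>n. R n \<subseteq> component_in X (U - \<Union>\<C>) x"
        proof
          fix x assume x: "x \<in> U - \<Union>\<C>"
          have sp: "W p - \<Union>\<C>p \<subseteq> U - \<Union>\<C>" and sq: "W q - \<Union>\<C>q \<subseteq> U - \<Union>\<C>"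
            using subW[of p] subW[of q] disj \<C>p(2) \<C>q(2) unfolding \<C>_def by blast+
          have "x \<in> W p - \<Union>\<C>p \<or> x \<in> W q - \<Union>\<C>q" using x UCW unfolding \<C>_def by blast
          then show "\<exists>R\<in>E. \<exists>n. R n \<subseteq> component_in X (U - \<Union>\<C>) x"
          proof
            assume "x \<in> W p - \<Union>\<C>p"
            then obtain R k where "R \<in> Ep" "R k \<subseteq> component_in X (W p - \<Union>\<C>p) x" using \<C>p(5) by blast
            then show ?thesis using component_in_mono[OF sp] unfolding Ep_def by blast
          next
            assume "x \<in> W q - \<Union>\<C>q"
            then obtain R k where "R \<in> E - Ep" "R k \<subseteq> component_in X (W q - \<Union>\<C>q) x" using \<C>q(5) by blast
            then show ?thesis using component_in_mono[OF sq] by blast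
          qed
        qed
      qed
    qed
  qed
qed

end

section \<open>Ideal boundary components as escaping sequences\<close>

lemma ideal_boundary_component_escapes:
  assumes "ideal_boundary_component (subtopology X U) P" "openin X U"
  shows "escapes X U P"
proof -
  let ?Y = "subtopology X U"
  have top: "topspace ?Y = U" using openin_subset[OF assms(2)] by auto
  have P: "decseq P" "\<And>n. P n \<noteq> {}" "\<And>n. connectedin ?Y (P n)" "(\<Inter>n. ?Y closure_of P n) = {}"
    using assms(1) by (auto simp: ideal_boundary_component_def)
  have PU: "P n \<subseteq> U" "connectedin X (P n)" for n using P(3)[of n] by (auto simp: connectedin_subtopology)
  have "\<exists>n. P n \<inter> L = {}" if L: "compactin X L" "L \<subseteq> U" for L
  proof -
    have cL: "compactin ?Y L" using L by (simp add: compactin_subtopology)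
    define V where "V n = U - ?Y closure_of P n" for n
    have "openin ?Y (V n)" for n unfolding V_def using top by (metis closedin_closure_of openin_diff openin_topspace)
    moreover have "L \<subseteq> \<Union>(range V)" using P(4) L(2) unfolding V_def by blast
    ultimately obtain \<F> where F: "finite \<F>" "\<F> \<subseteq> range V" "L \<subseteq> \<Union>\<F>"
      using compactinD[OF cL, of "range V"] by (metis rangeE)
    obtain J where J: "finite J" "\<F> = V ` J" using finite_subset_image[OF F(1,2)] by metis
    obtain n where n: "\<forall>j\<in>J. j \<le> n" using J(1) finite_nat_set_iff_bounded_le by metis
    have "x \<notin> P n" if "x \<in> L" for x
    proof
      assume x: "x \<in> P n"
      have "x \<in> \<Union>(V ` J)" using subsetD[OF F(3) \<open>x \<in> L\<close>] J(2) by simp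
      then obtain j where j: "j \<in> J" "x \<in> V j" by auto
      have "P n \<subseteq> P j" using decseqD[OF P(1)] n j(1) by simp
      moreover have "P j \<subseteq> ?Y closure_of P j" using PU(1) top by (intro closure_of_subset) simp
      ultimately show False using x j(2) unfolding V_def by blast
    qed
    then show ?thesis by blast
  qed
  then show ?thesis using P(1,2) PU unfolding escapes_def by auto
qed

text \<open>The compact frontier of \<open>Q m\<close> separates: a connected set \<open>P n\<close> that misses this frontier and
does not lie in \<open>Q m\<close> is disjoint from \<open>Q m\<close>.\<close>

lemma separated_in_if_not_eventually_inside:
  assumes U: "openin X U" and P: "ideal_boundary_component (subtopology X U) P"
    and Q: "ideal_boundary_component (subtopology X U) Q" and no: "\<And>n. \<not> P n \<subseteq> Q m"
  shows "separated_in X U P Q"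
proof -
  let ?Y = "subtopology X U"
  have top: "topspace ?Y = U" using openin_subset[OF U] by auto
  let ?L = "?Y frontier_of Q m"
  have "compactin ?Y ?L" using Q by (simp add: ideal_boundary_component_def)
  then have L: "compactin X ?L" "?L \<subseteq> U" by (simp_all add: compactin_subtopology)
  obtain a where a: "\<forall>n\<ge>a. P n \<subseteq> U \<and> P n \<inter> ?L = {}"
    using escapes_avoid[OF ideal_boundary_component_escapes[OF P U] L] by blast
  define n where "n = max a m"
  have PL: "P n \<inter> ?L = {}" using a by (simp add: n_def)
  have QQ: "Q n \<subseteq> Q m" using Q by (simp add: ideal_boundary_component_def n_def decseqD)
  have "connectedin ?Y (P n)" using P by (simp add: ideal_boundary_component_def)
  then have PQ: "P n \<inter> Q m = {}" using connectedin_Int_frontier_of[of ?Y "P n" "Q m"] PL no[of n] by blast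
  have "\<not> joined_in X (U - ?L) p q" if pq: "p \<in> P n" "q \<in> Q n" for p q
  proof
    assume "joined_in X (U - ?L) p q"
    then obtain T where T: "connectedin X T" "T \<subseteq> U - ?L" "p \<in> T" "q \<in> T" by (auto simp: joined_in_iff)
    have "connectedin ?Y T" using T by (auto simp: connectedin_subtopology)
    moreover have "T \<inter> Q m \<noteq> {}" "T - Q m \<noteq> {}" using T pq QQ PQ by blast+
    ultimately have "T \<inter> ?L \<noteq> {}" by (rule connectedin_Int_frontier_of)
    then show False using T(2) by blast
  qed
  then show ?thesis unfolding separated_in_def using L by blast
qed

lemma inequivalent_separated_in:
  assumes U: "openin X U" and P: "ideal_boundary_component (subtopology X U) P"
    and Q: "ideal_boundary_component (subtopology X U) Q"
    and ne: "(P, Q) \<notin> ideal_boundary_equiv (subtopology X U)"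
  shows "separated_in X U P Q"
proof -
  have "(\<exists>m. \<forall>n. \<not> P n \<subseteq> Q m) \<or> (\<exists>m. \<forall>n. \<not> Q n \<subseteq> P m)"
    using ne P Q by (auto simp: ideal_boundary_equiv_def)
  then show ?thesis
    using separated_in_if_not_eventually_inside[OF U P Q] separated_in_if_not_eventually_inside[OF U Q P]
      separated_in_sym by metis
qed

context surface_atlas
begin

section \<open>Ends of a residual domain and the genus\<close>

lemma residual_domain_open_connected:
  assumes "compactin X K" "residual_domain X K U"
  shows "openin X U" "connectedin X U" "X closure_of U \<subseteq> U \<union> K"
proof -
  let ?S = "topspace X - K"
  have openS: "openin X ?S" using compactin_imp_closedin[OF hausdorff assms(1)] by blast
  obtain x where x: "x \<in> ?S" "U = component_in X ?S x"
    using assms(2) by (auto simp: residual_domain_def connected_components_of_def)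
  show "openin X U" unfolding x(2) by (rule openin_component_in[OF openS])
  show conn: "connectedin X U" unfolding x(2) by (rule connectedin_component_in)
  show "X closure_of U \<subseteq> U \<union> K"
  proof
    fix z assume z: "z \<in> X closure_of U"
    show "z \<in> U \<union> K"
    proof (cases "z \<in> K")
      case False
      have zS: "z \<in> ?S" using z False in_closure_of by fastforce
      let ?Z = "component_in X ?S z"
      have zZ: "z \<in> ?Z" using joined_in_refl[OF zS] by simp
      then have "?Z \<inter> U \<noteq> {}" using z openin_component_in[OF openS, of z] unfolding in_closure_of by blast
      then have "?Z \<subseteq> U"
        unfolding x(2) by (rule component_in_absorb[OF connectedin_component_in component_in_subset])
      then show ?thesis using zZ by blast
    qed simp
  qed
qed

text \<open>By compactness, the closures of the \<open>P n\<close> in the whole surface have a common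
point; it cannot lie in \<open>U\<close>, because the closures in \<open>U\<close> have empty intersection.\<close>

lemma ideal_boundary_component_touches:
  assumes "compact_space X" "compactin X K" "residual_domain X K U"
    and P: "ideal_boundary_component (subtopology X U) P"
  shows "\<exists>z\<in>K. \<forall>n. z \<in> X closure_of P n"
proof -
  note U = residual_domain_open_connected[OF assms(2,3)]
  have dec: "decseq P" and ne: "P n \<noteq> {}" and PU: "P n \<subseteq> U" and "connectedin (subtopology X U) (P n)"
    and int: "(\<Inter>n. subtopology X U closure_of P n) = {}" for n
    using P by (auto simp: ideal_boundary_component_def connectedin_subtopology)
  have PX: "P n \<subseteq> topspace X" for n using PU openin_subset[OF U(1)] by blast
  have "(\<Inter>n. X closure_of P n) \<noteq> {}"
  proof (rule compact_space_imp_nest[OF assms(1)])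
    show "X closure_of P n \<noteq> {}" for n using ne[of n] closure_of_subset[OF PX] by blast
    show "decseq (\<lambda>n. X closure_of P n)" using dec by (auto simp: decseq_def intro!: closure_of_mono)
  qed simp
  then obtain z where z: "\<And>n. z \<in> X closure_of P n" by blast
  have "z \<notin> U"
  proof
    assume "z \<in> U"
    then have "z \<in> subtopology X U closure_of P n" for n
      using z[of n] U(1) by (simp add: closure_of_subtopology_open)
    then show False using int by blast
  qed
  moreover have "z \<in> X closure_of U" using z[of 0] closure_of_mono[OF PU] by blast
  ultimately show ?thesis using z U(3) by blast
qed

text \<open>Together with \<open>Q\<close>, all components of \<open>U - D\<close> form a connected set \<open>R\<close>. If an open part of the
complement of \<open>D\<close> missed \<open>R\<close>, it would be disjoint from \<open>U\<close>; then it would be closed in \<open>X\<close> as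
well, because the rest of \<open>X\<close> is the union of another open part with \<open>U\<close>.\<close>

lemma connected_complement_of_curves:
  assumes X: "connected_space X" and U: "openin X U" and Q: "connectedin X Q" "Q \<noteq> {}" "Q \<inter> U = {}"
    and D: "closedin X D" "D \<subseteq> U"
    and touch: "\<And>x. x \<in> U - D \<Longrightarrow> Q \<inter> X closure_of component_in X (U - D) x \<noteq> {}"
  shows "connectedin X (topspace X - D)"
proof -
  let ?S = "topspace X - D"
  define R where "R = \<Union>(insert Q ((\<lambda>x. Q \<union> component_in X (U - D) x) ` (U - D)))"
  have UX: "U - D \<subseteq> topspace X" using openin_subset[OF U] by blast
  have "connectedin X R" unfolding R_def
  proof (rule connectedin_Union)
    fix S assume "S \<in> insert Q ((\<lambda>x. Q \<union> component_in X (U - D) x) ` (U - D))"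
    then consider "S = Q" | x where "x \<in> U - D" "S = Q \<union> component_in X (U - D) x" by blast
    then show "connectedin X S"
    proof cases
      case 2
      let ?W = "component_in X (U - D) x"
      obtain z where z: "z \<in> Q" "z \<in> X closure_of ?W" using touch[OF 2(1)] by blast
      have W: "connectedin X ?W" by (rule connectedin_component_in)
      have "?W \<subseteq> X closure_of ?W" using closure_of_subset connectedin_subset_topspace[OF W] by blast
      then have "connectedin X (insert z ?W)"
        using z(2) by (intro connectedin_intermediate_closure_of[OF W]) auto
      then have "connectedin X (Q \<union> insert z ?W)" using z(1) by (intro connectedin_Un[OF Q(1)]) auto
      moreover have "Q \<union> insert z ?W = S" using 2(2) z(1) by blast
      ultimately show ?thesis by simp
    qed (use Q in simp)
  qed (use Q in auto)
  moreover have R: "Q \<subseteq> R" "U - D \<subseteq> R" "R \<subseteq> ?S"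
  proof -
    show "Q \<subseteq> R" unfolding R_def by blast
    show "U - D \<subseteq> R"
    proof
      fix x assume x: "x \<in> U - D"
      then have "x \<in> component_in X (U - D) x" using joined_in_refl[OF x UX] by simp
      then show "x \<in> R" using x unfolding R_def by blast
    qed
    have "component_in X (U - D) x \<subseteq> U - D" for x by (rule component_in_subset)
    moreover have "Q \<subseteq> ?S" using connectedin_subset_topspace[OF Q(1)] Q(3) D(2) by blast
    ultimately show "R \<subseteq> ?S" using UX unfolding R_def by blast
  qed
  have openS: "openin X ?S" using D(1) by blast
  have half: False if E: "openin X E1" "openin X E2" "?S \<subseteq> E1 \<union> E2" "E1 \<inter> E2 \<inter> ?S = {}" "E2 \<inter> ?S \<noteq> {}" "R \<inter> E2 = {}" for E1 E2
  proof -
    have top: "connectedin X (topspace X)" using X by (simp add: connectedin_topspace)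
    have "topspace X \<inter> (E2 \<inter> ?S) = {}"
    proof (rule connectedin_open_split[OF top])
      show "openin X (E1 \<inter> ?S \<union> U)" "openin X (E2 \<inter> ?S)" using E U openS by auto
      show "topspace X \<subseteq> E1 \<inter> ?S \<union> U \<union> E2 \<inter> ?S" using E(3) D(2) by blast
      show "(E1 \<inter> ?S \<union> U) \<inter> (E2 \<inter> ?S) \<inter> topspace X = {}" using E(4,6) R(2) by blast
      show "topspace X \<inter> (E1 \<inter> ?S \<union> U) \<noteq> {}" using R(1,3) Q(2) E(3,6) by blast
    qed
    then show False using E(5) by blast
  qed
  show ?thesis unfolding connectedin
  proof (intro conjI notI)
    show "?S \<subseteq> topspace X" by blast
    assume "\<exists>E1 E2. openin X E1 \<and> openin X E2 \<and> ?S \<subseteq> E1 \<union> E2 \<and> E1 \<inter> E2 \<inter> ?S = {} \<and> E1 \<inter> ?S \<noteq> {} \<and> E2 \<inter> ?S \<noteq> {}"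
    then obtain E1 E2 where E: "openin X E1" "openin X E2" "?S \<subseteq> E1 \<union> E2" "E1 \<inter> E2 \<inter> ?S = {}" "E1 \<inter> ?S \<noteq> {}" "E2 \<inter> ?S \<noteq> {}" by blast
    have "R \<inter> E1 = {} \<or> R \<inter> E2 = {}"
      using connectedin_open_split[OF \<open>connectedin X R\<close> E(1,2)] E(3,4) R(3) by blast
    then show False using half[OF E(1-4) E(6)] half[OF E(2,1)] E by (metis Un_commute inf_commute)
  qed
qed

text \<open>The curves of \<open>nonseparating_curve_family\<close> do not disconnect \<open>X\<close>, so there are
at most \<open>genus X\<close> of them.\<close>

lemma ends_at_connected_set_le_genus:
  assumes X: "connected_space X" and U: "openin X U" "connectedin X U"
    and Q: "connectedin X Q" "Q \<noteq> {}" "Q \<inter> U = {}"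
    and E: "finite E" "E \<noteq> {}" "\<And>P. P \<in> E \<Longrightarrow> escapes X U P"
      "\<And>P P'. P \<in> E \<Longrightarrow> P' \<in> E \<Longrightarrow> P \<noteq> P' \<Longrightarrow> separated_in X U P P'"
    and touch: "\<And>P. P \<in> E \<Longrightarrow> \<exists>z\<in>Q. \<forall>n. z \<in> X closure_of P n"
  shows "enat (card E) \<le> genus X + 1"
proof -
  obtain \<C> where \<C>: "finite \<C>" "\<forall>C\<in>\<C>. simple_closed_curve_in X C \<and> C \<subseteq> U" "pairwise disjnt \<C>"
     "card E \<le> card \<C> + 1" "\<forall>x\<in>U - \<Union>\<C>. \<exists>P\<in>E. \<exists>n. P n \<subseteq> component_in X (U - \<Union>\<C>) x"
    using nonseparating_curve_family[OF E(1,2) U] E(3,4) by metis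
  have "connectedin X (topspace X - \<Union>\<C>)"
  proof (rule connected_complement_of_curves[OF X U(1) Q])
    show "closedin X (\<Union>\<C>)"
      using \<C>(1,2) compactin_imp_closedin[OF hausdorff compactin_simple_closed_curve] by (intro closedin_Union) auto
    show "\<Union>\<C> \<subseteq> U" using \<C>(2) by blast
    fix x assume "x \<in> U - \<Union>\<C>"
    then obtain P n where P: "P \<in> E" "P n \<subseteq> component_in X (U - \<Union>\<C>) x" using \<C>(5) by blast
    obtain z where "z \<in> Q" "z \<in> X closure_of P n" using touch[OF P(1)] by blast
    then show "Q \<inter> X closure_of component_in X (U - \<Union>\<C>) x \<noteq> {}" using closure_of_mono[OF P(2)] by blast
  qed
  then have "connected_space (subtopology X (topspace X - \<Union>\<C>))" by (rule connected_space_subtopology)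
  then have "enat (card \<C>) \<le> genus X"
    unfolding genus_def using \<C>(1,2,3) by (intro Sup_upper) blast
  then have "enat (card \<C>) + 1 \<le> genus X + 1" by (rule add_right_mono)
  moreover have "enat (card E) \<le> enat (card \<C>) + 1" using \<C>(4) by (simp add: one_enat_def)
  ultimately show ?thesis by (rule order_trans[rotated])
qed

lemma card_ends_le:
  assumes X: "connected_space X" "compact_space X" and K: "compactin X K" "residual_domain X K U"
    and fin: "finite (connected_components_of (subtopology X K))"
    and S: "finite S" "S \<subseteq> ideal_boundary_points (subtopology X U)"
    and g: "genus X = enat g"
  shows "card S \<le> card (connected_components_of (subtopology X K)) * (g + 1)"
proof (cases "S = {}")
  case False
  let ?Y = "subtopology X U" and ?K = "connected_components_of (subtopology X K)"
  note U = residual_domain_open_connected[OF K]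
  note eq = equiv_ideal_boundary_equiv[of ?Y]
  have "\<exists>P. e = ideal_boundary_equiv ?Y `` {P} \<and> ideal_boundary_component ?Y P" if "e \<in> S" for e
    using that S(2) unfolding ideal_boundary_points_def quotient_def by blast
  then obtain rep where rep: "\<And>e. e \<in> S \<Longrightarrow> e = ideal_boundary_equiv ?Y `` {rep e}"
    "\<And>e. e \<in> S \<Longrightarrow> ideal_boundary_component ?Y (rep e)" by metis
  have inj: "inj_on rep S" using rep(1) by (metis inj_onI)
  have sep: "separated_in X U (rep e) (rep e')" if "e \<in> S" "e' \<in> S" "e \<noteq> e'" for e e'
  proof (rule inequivalent_separated_in[OF U(1) rep(2) rep(2)])
    show "(rep e, rep e') \<notin> ideal_boundary_equiv ?Y"
      using equiv_class_eq[OF eq] rep(1)[OF that(1)] rep(1)[OF that(2)] that(3) by metis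
  qed (use that in auto)
  have KX: "topspace (subtopology X K) = K" using compactin_subset_topspace[OF K(1)] by auto
  have "\<exists>Q\<in>?K. \<exists>z\<in>Q. \<forall>n. z \<in> X closure_of rep e n" if e: "e \<in> S" for e
  proof -
    obtain z where z: "z \<in> K" "\<forall>n. z \<in> X closure_of rep e n"
      using ideal_boundary_component_touches[OF X(2) K rep(2)[OF e]] by blast
    have "z \<in> \<Union>?K" using z(1) KX Union_connected_components_of[of "subtopology X K"] by simp
    then show ?thesis using z(2) by blast
  qed
  then obtain \<kappa> where \<kappa>: "\<And>e. e \<in> S \<Longrightarrow> \<kappa> e \<in> ?K" "\<And>e. e \<in> S \<Longrightarrow> \<exists>z\<in>\<kappa> e. \<forall>n. z \<in> X closure_of rep e n"
    by metis
  have "?K \<noteq> {}" using \<kappa>(1) False by blast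
  then obtain Q where Q: "Q \<in> ?K" "card S \<le> card (\<kappa> -` {Q} \<inter> S) * card ?K"
    using pigeonhole_card[of \<kappa> S ?K] \<kappa>(1) S(1) fin by blast
  let ?F = "\<kappa> -` {Q} \<inter> S"
  have "card ?F \<le> g + 1"
  proof (cases "?F = {}")
    case F: False
    have "connectedin (subtopology X K) Q" using Q(1) by (rule connectedin_connected_components_of)
    then have Qc: "connectedin X Q" "Q \<subseteq> K" by (simp_all add: connectedin_subtopology)
    have "Q \<noteq> {}" using Q(1) nonempty_connected_components_of by blast
    moreover have "Q \<inter> U = {}"
      using Qc(2) K(2) connected_components_of_subset[of U "subtopology X (topspace X - K)"]
      by (auto simp: residual_domain_def)
    ultimately have "enat (card (rep ` ?F)) \<le> genus X + 1"
    proof (intro ends_at_connected_set_le_genus[OF X(1) U(1,2) Qc(1)])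
      show "finite (rep ` ?F)" using S(1) by simp
      show "rep ` ?F \<noteq> {}" using F by simp
      show "escapes X U P" if "P \<in> rep ` ?F" for P
        using that ideal_boundary_component_escapes[OF rep(2) U(1)] by auto
      show "separated_in X U P P'" if "P \<in> rep ` ?F" "P' \<in> rep ` ?F" "P \<noteq> P'" for P P'
        using that sep by auto
      show "\<exists>z\<in>Q. \<forall>n. z \<in> X closure_of P n" if "P \<in> rep ` ?F" for P
        using that \<kappa>(2) by auto
    qed
    moreover have "card (rep ` ?F) = card ?F" using inj by (intro card_image) (auto intro: inj_on_subset)
    ultimately show ?thesis by (simp add: g one_enat_def)
  qed simp
  then have "card ?F * card ?K \<le> (g + 1) * card ?K" by (rule mult_right_mono) simp
  then show ?thesis using Q(2) by (simp add: mult.commute)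
qed simp

end

theorem proposition2p15:
  fixes X :: "'a topology" and K U :: "'a set" and m :: nat
  assumes "smooth_surface X" and "compact_space X"
    and "compactin X K"
    and "residual_domain X K U"
    and "finite (connected_components_of (subtopology X K))"
    and "card (connected_components_of (subtopology X K)) = m"
  shows "num_ideal_boundary_points (subtopology X U) \<le> enat m * (genus X + 1)"
proof -
  obtain \<A> where "smooth_atlas X \<A>" and X: "connected_space X" "Hausdorff_space X"
    using assms(1) by (auto simp: smooth_surface_def)
  then interpret surface_atlas X \<A> by unfold_locales
  let ?B = "ideal_boundary_points (subtopology X U)"
  show ?thesis
  proof (cases "genus X")
    case (enat g)
    note le = card_ends_le[OF X(1) assms(2-5) _ _ enat, unfolded assms(6)]
    have fin: "finite ?B"
    proof (rule ccontr)
      assume "infinite ?B"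
      then obtain S where "finite S" "card S = m * (g + 1) + 1" "S \<subseteq> ?B"
        using infinite_arbitrarily_large by blast
      then show False using le[of S] by simp
    qed
    then show ?thesis using le[OF fin order_refl]
      by (simp add: num_ideal_boundary_points_def enat one_enat_def)
  next
    \<comment> \<open>For \<open>m = 0\<close> the bound is zero even if the genus is infinite; then \<open>K\<close> is empty, and an end would have nowhere to accumulate.\<close>
    case infinity
    show ?thesis
    proof (cases "m = 0")
      case True
      then have "connected_components_of (subtopology X K) = {}" using assms(5,6) by simp
      then have "topspace (subtopology X K) = {}"
        using Union_connected_components_of[of "subtopology X K"] by simp
      then have "K = {}" using compactin_subset_topspace[OF assms(3)] by auto
      then have "?B = {}"
        using ideal_boundary_component_touches[OF assms(2-4)]
        by (auto simp: ideal_boundary_points_def quotient_def)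
      then show ?thesis by (simp add: num_ideal_boundary_points_def flip: zero_enat_def)
    next
      case False
      then show ?thesis by (simp add: infinity)
    qed
  qed
qed

end
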